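(* For $\alpha>0$ consider the 3-stage Runge--Kutta scheme $M_h^{\alpha}$ with tableau $$ \begin{array}{c|ccc} \frac12 - \alpha & -\frac{3}{4} \alpha + \frac{1}{16 \alpha} + \frac{1}{48 \alpha^2} & \frac{1}{2} - \frac{1}{24 \alpha^2} & -\frac{1}{4} \alpha - \frac{1}{16 \alpha} + \frac{1}{48 \alpha^2} \\[.15cm] \frac12 & \frac{1}{16 \alpha} + \frac{1}{48 \alpha^2} & \frac{1}{2} - \frac{1}{24 \alpha^2} & -\frac{1}{16 \alpha} + \frac{1}{48 \alpha^2} \\[.15cm] \frac12 + \alpha & \frac{1}{4} \alpha + \frac{1}{16 \alpha} + \frac{1}{48 \alpha^2} & \frac{1}{2} - \frac{1}{24 \alpha^2} & \frac{3}{4} \alpha - \frac{1}{16 \alpha} + \frac{1}{48 \alpha^2} \\[.15cm] \hline & \frac{1}{24 \alpha^2} & 1 - \frac{1}{12 \alpha^2} & \frac{1}{24 \alpha^2} \end{array} $$ Then $M_h^{\alpha}$ is symplectic if and only if $\alpha=\sqrt3/6$. In this case, the method $M_h^{\sqrt3/6}$ coincides (in the sense of equivalence of Runge--Kutta methods) with the two-stage Gauss--Legendre method of order 4, with tableau $$ \begin{array}{c|cc} \frac{1}{2} - \frac{\sqrt{3}}{6} & \frac{1}{4} & \frac{1}{4} - \frac{\sqrt{3}}{6} \\[.15cm] \frac{1}{2} + \frac{\sqrt{3}}{6} & \frac{1}{4} + \frac{\sqrt{3}}{6} & \frac{1}{4} \\[.15cm] \hline & \frac{1}{2} & \frac{1}{2}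 \end{array} $$ and it can be obtained as the composition $\Psi_{h/2}\circ\Phi_{h/2}$ (first a step of $\Phi_{h/2}$, then a step of $\Psi_{h/2}$), where $\Phi_h$ and $\Psi_h$ are the two-stage Runge--Kutta methods with tableaux $$ \Phi_h:\quad \begin{array}{c|cc} 1 - \frac{\sqrt{3}}{3} & \frac{1}{2} & \frac{1}{2} - \frac{\sqrt{3}}{3} \\[.15cm] 1 + \frac{\sqrt{3}}{3} & \frac{1}{2} + \frac{\sqrt{3}}{3} & \frac{1}{2} \\[.15cm] \hline & \frac{1}{2} + \frac{\sqrt{3}}{4} & \frac{1}{2} - \frac{\sqrt{3}}{4} \end{array} \qquad \Psi_h:\quad \begin{array}{c|cc} - \frac{\sqrt{3}}{3} & -\frac{\sqrt{3}}{4} & -\frac{\sqrt{3}}{12} \\[.15cm] \frac{\sqrt{3}}{3} & \frac{\sqrt{3}}{12} & \frac{\sqrt{3}}{4} \\[.15cm] \hline & \frac{1}{2} - \frac{\sqrt{3}}{4} & \frac{1}{2} + \frac{\sqrt{3}}{4} \end{array} $$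
   Context: An $s$-stage Runge--Kutta method with tableau $\begin{array}{c|c} c & A\\ \hline & b^\top\end{array}$, $A=(a_{ij})\in\mathbb{R}^{s\times s}$, $b\in\mathbb{R}^s$, $c_i=\sum_j a_{ij}$, applied with stepsize $h$ to $y'=f(y)$, maps $y_0$ to $y_1=y_0+h\sum_i b_i f(Y_i)$, where the internal stages solve $Y_i=y_0+h\sum_j a_{ij}f(Y_j)$, $i=1,\dots,s$ (for smooth $f$ and sufficiently small $|h|$, the solution near $y_0$ is taken). The same letter denotes the method and its one-step map. Two Runge--Kutta methods are equivalent (coincide) if they define the same one-step map for every smooth $f$ and every sufficiently small $|h|$. A Runge--Kutta method is symplectic if, applied to any Hamiltonian system $y'=J\nabla H(y)$, $y\in\mathbb{R}^{2m}$, $J=\begin{pmatrix}0&I\\-I&0\end{pmatrix}$ with $I$ the $m\times m$ identity matrix and $H$ smooth, its one-step map $y_0\mapsto y_1$ is a symplectic map (its Jacobian $S$ satisfies $S^\top JS=J$) for all sufficiently small $|h|$. *)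

theory Defs
  imports "HOL-Analysis.Analysis"
begin

section \<open>Smooth functions on spaces of arbitrary finite dimension\<close>

text \<open>
  Symplecticity and equivalence of Runge--Kutta methods quantify over the dimension of the
  differential equation, so the dimension cannot be a type.  Points of d-dimensional space are
  the elements of \<open>topspace (Euclidean_space d)\<close>, i.e. sequences of reals that vanish from
  index \<open>d\<close> on; \<open>L2_set _ {..<d}\<close> is the Euclidean norm.
\<close>

type_synonym point = "nat \<Rightarrow> real"

definition partial_deriv :: "nat \<Rightarrow> (point \<Rightarrow> real) \<Rightarrow> point \<Rightarrow> real" where
  "partial_deriv i F x = deriv (\<lambda>t. F (x(i := t))) (x i)"

primrec C_diff :: "nat \<Rightarrow> nat \<Rightarrow> (point \<Rightarrow> real) \<Rightarrow> bool" where
  "C_diff 0 d F \<longleftrightarrow> continuous_map (Euclidean_space d) euclideanreal F"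
| "C_diff (Suc k) d F \<longleftrightarrow>
     continuous_map (Euclidean_space d) euclideanreal F \<and>
     (\<forall>i<d. (\<forall>x \<in> topspace (Euclidean_space d). (\<lambda>t. F (x(i := t))) differentiable (at (x i))) \<and>
            C_diff k d (partial_deriv i F))"

definition smooth_fun :: "nat \<Rightarrow> (point \<Rightarrow> real) \<Rightarrow> bool" where
  "smooth_fun d F \<longleftrightarrow> (\<forall>k. C_diff k d F)"

definition smooth_field :: "nat \<Rightarrow> (point \<Rightarrow> point) \<Rightarrow> bool" where
  "smooth_field d f \<longleftrightarrow>
     (\<forall>y \<in> topspace (Euclidean_space d). f y \<in> topspace (Euclidean_space d)) \<and>
     (\<forall>i<d. smooth_fun d (\<lambda>y. f y i))"

text \<open>Frechet differentiability at \<open>y\<close>, with Jacobian matrix \<open>S\<close> (indices below \<open>d\<close>).\<close>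

definition has_jacobian :: "nat \<Rightarrow> (point \<Rightarrow> point) \<Rightarrow> (nat \<Rightarrow> nat \<Rightarrow> real) \<Rightarrow> point \<Rightarrow> bool" where
  "has_jacobian d F S y \<longleftrightarrow>
     (\<forall>\<epsilon>>0. \<exists>\<delta>>0. \<forall>x \<in> topspace (Euclidean_space d).
        L2_set (\<lambda>j. x j - y j) {..<d} < \<delta> \<longrightarrow>
        L2_set (\<lambda>i. F x i - F y i - (\<Sum>j<d. S i j * (x j - y j))) {..<d}
          \<le> \<epsilon> * L2_set (\<lambda>j. x j - y j) {..<d})"

section \<open>Runge--Kutta methods and their one-step maps\<close>

text \<open>The number of stages is the length of the weight list; \<open>rk_A\<close> lists the rows of the matrix.\<close>

record rk_tableau =
  rk_c :: "real list"
  rk_A :: "real list list"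
  rk_b :: "real list"

abbreviation rk_stages :: "rk_tableau \<Rightarrow> nat" where
  "rk_stages M \<equiv> length (rk_b M)"

definition row_sum_condition :: "rk_tableau \<Rightarrow> bool" where
  "row_sum_condition M \<longleftrightarrow> (\<forall>i < rk_stages M. rk_c M ! i = (\<Sum>j < rk_stages M. rk_A M ! i ! j))"

definition solves_stages ::
    "rk_tableau \<Rightarrow> nat \<Rightarrow> (point \<Rightarrow> point) \<Rightarrow> real \<Rightarrow> point \<Rightarrow> (nat \<Rightarrow> point) \<Rightarrow> bool" where
  "solves_stages M d f h y0 Y \<longleftrightarrow>
     (\<forall>i < rk_stages M. Y i \<in> topspace (Euclidean_space d) \<and>
        Y i = (\<lambda>k. y0 k + h * (\<Sum>j < rk_stages M. rk_A M ! i ! j * f (Y j) k)))"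

text \<open>
  The stage equations may have several solutions; the one near \<open>y0\<close> is taken.  For smooth \<open>f\<close>
  and small \<open>h\<close> it is the only solution in a fixed ball around \<open>y0\<close>, hence the nearest one.
\<close>

definition internal_stages ::
    "rk_tableau \<Rightarrow> nat \<Rightarrow> (point \<Rightarrow> point) \<Rightarrow> real \<Rightarrow> point \<Rightarrow> nat \<Rightarrow> point" where
  "internal_stages M d f h y0 =
     arg_min (\<lambda>Y. \<Sum>i < rk_stages M. L2_set (\<lambda>k. Y i k - y0 k) {..<d}) (solves_stages M d f h y0)"

definition rk_map :: "rk_tableau \<Rightarrow> nat \<Rightarrow> (point \<Rightarrow> point) \<Rightarrow> real \<Rightarrow> point \<Rightarrow> point" where
  "rk_map M d f h y0 =
     (\<lambda>k. y0 k + h * (\<Sum>i < rk_stages M. rk_b M ! i * f (internal_stages M d f h y0 i) k))"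

text \<open>
  How small \<open>h\<close> has to be depends on \<open>f\<close> and, since \<open>f\<close> need not be globally Lipschitz, on the
  initial value; \<open>for sufficiently small h\<close> is therefore read uniformly on compact sets of
  initial values.
\<close>

definition same_one_step_map ::
    "(nat \<Rightarrow> (point \<Rightarrow> point) \<Rightarrow> real \<Rightarrow> point \<Rightarrow> point) \<Rightarrow>
     (nat \<Rightarrow> (point \<Rightarrow> point) \<Rightarrow> real \<Rightarrow> point \<Rightarrow> point) \<Rightarrow> bool" where
  "same_one_step_map P Q \<longleftrightarrow>
     (\<forall>d f K. smooth_field d f \<longrightarrow> compactin (Euclidean_space d) K \<longrightarrow>
        (\<forall>\<^sub>F h in nhds 0. \<forall>y\<in>K. P d f h y = Q d f h y))"

definition rk_equivalent :: "rk_tableau \<Rightarrow> rk_tableau \<Rightarrow> bool" where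
  "rk_equivalent M N \<longleftrightarrow> same_one_step_map (rk_map M) (rk_map N)"

section \<open>Symplecticity\<close>

definition J_mat :: "nat \<Rightarrow> nat \<Rightarrow> nat \<Rightarrow> real" where
  "J_mat m i j = (if i < m \<and> j = i + m then 1 else if j < m \<and> i = j + m then -1 else 0)"

definition hamiltonian_field :: "nat \<Rightarrow> (point \<Rightarrow> real) \<Rightarrow> point \<Rightarrow> point" where
  "hamiltonian_field m H y = (\<lambda>i. \<Sum>j < 2 * m. J_mat m i j * partial_deriv j H y)"

definition symplectic_matrix :: "nat \<Rightarrow> (nat \<Rightarrow> nat \<Rightarrow> real) \<Rightarrow> bool" where
  "symplectic_matrix m S \<longleftrightarrow>
     (\<forall>i < 2 * m. \<forall>j < 2 * m.
        (\<Sum>k < 2 * m. \<Sum>l < 2 * m. S k i * J_mat m k l * S l j) = J_mat m i j)"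

definition symplectic_at :: "nat \<Rightarrow> (point \<Rightarrow> point) \<Rightarrow> point \<Rightarrow> bool" where
  "symplectic_at m F y \<longleftrightarrow> (\<exists>S. has_jacobian (2 * m) F S y \<and> symplectic_matrix m S)"

definition rk_symplectic :: "rk_tableau \<Rightarrow> bool" where
  "rk_symplectic M \<longleftrightarrow>
     (\<forall>m H K. smooth_fun (2 * m) H \<longrightarrow> compactin (Euclidean_space (2 * m)) K \<longrightarrow>
        (\<forall>\<^sub>F h in nhds 0. \<forall>y\<in>K. symplectic_at m (rk_map M (2 * m) (hamiltonian_field m H) h) y))"

section \<open>The methods\<close>

definition M_scheme :: "real \<Rightarrow> rk_tableau" where
  "M_scheme \<alpha> = \<lparr>
     rk_c = [1/2 - \<alpha>, 1/2, 1/2 + \<alpha>],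
     rk_A =
      [[- (3/4) * \<alpha> + 1 / (16 * \<alpha>) + 1 / (48 * \<alpha>\<^sup>2), 1/2 - 1 / (24 * \<alpha>\<^sup>2),
          - (1/4) * \<alpha> - 1 / (16 * \<alpha>) + 1 / (48 * \<alpha>\<^sup>2)],
       [1 / (16 * \<alpha>) + 1 / (48 * \<alpha>\<^sup>2), 1/2 - 1 / (24 * \<alpha>\<^sup>2),
          - 1 / (16 * \<alpha>) + 1 / (48 * \<alpha>\<^sup>2)],
       [1/4 * \<alpha> + 1 / (16 * \<alpha>) + 1 / (48 * \<alpha>\<^sup>2), 1/2 - 1 / (24 * \<alpha>\<^sup>2),
          3/4 * \<alpha> - 1 / (16 * \<alpha>) + 1 / (48 * \<alpha>\<^sup>2)]],
     rk_b = [1 / (24 * \<alpha>\<^sup>2), 1 - 1 / (12 * \<alpha>\<^sup>2), 1 / (24 * \<alpha>\<^sup>2)] \<rparr>"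

definition gauss_legendre2 :: rk_tableau where
  "gauss_legendre2 = \<lparr>
     rk_c = [1/2 - sqrt 3 / 6, 1/2 + sqrt 3 / 6],
     rk_A =
      [[1/4, 1/4 - sqrt 3 / 6],
       [1/4 + sqrt 3 / 6, 1/4]],
     rk_b = [1/2, 1/2] \<rparr>"

definition Phi_scheme :: rk_tableau where
  "Phi_scheme = \<lparr>
     rk_c = [1 - sqrt 3 / 3, 1 + sqrt 3 / 3],
     rk_A =
      [[1/2, 1/2 - sqrt 3 / 3],
       [1/2 + sqrt 3 / 3, 1/2]],
     rk_b = [1/2 + sqrt 3 / 4, 1/2 - sqrt 3 / 4] \<rparr>"

definition Psi_scheme :: rk_tableau where
  "Psi_scheme = \<lparr>
     rk_c = [- (sqrt 3 / 3), sqrt 3 / 3],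
     rk_A =
      [[- (sqrt 3 / 4), - (sqrt 3 / 12)],
       [sqrt 3 / 12, sqrt 3 / 4]],
     rk_b = [1/2 - sqrt 3 / 4, 1/2 + sqrt 3 / 4] \<rparr>"

text \<open>
  The nodes do not enter the one-step map for autonomous systems; they satisfy the convention
  that they are the row sums of the matrix.
\<close>

lemma row_sum_condition_M_scheme: "row_sum_condition (M_scheme \<alpha>)"
  by (auto simp: row_sum_condition_def M_scheme_def less_Suc_eq numeral_3_eq_3 field_simps)

lemma row_sum_condition_gauss_legendre2: "row_sum_condition gauss_legendre2"
  by (auto simp: row_sum_condition_def gauss_legendre2_def less_Suc_eq numeral_2_eq_2 field_simps)

lemma row_sum_condition_Phi_scheme: "row_sum_condition Phi_scheme"
  by (auto simp: row_sum_condition_def Phi_scheme_def less_Suc_eq numeral_2_eq_2 field_simps)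

lemma row_sum_condition_Psi_scheme: "row_sum_condition Psi_scheme"
  by (auto simp: row_sum_condition_def Psi_scheme_def less_Suc_eq numeral_2_eq_2 field_simps)

end

theory Submission
  imports Defs
begin

text \<open>
  At \<open>\<alpha> = sqrt 3 / 6\<close> the middle stage of the scheme has weight 0 and its column of the matrix vanishes,
  and the two outer stages are exactly those of the two-stage Gauss method. Hence the one-step maps
  agree. The two half steps of the composition also have these outer stages as their
  own stages. All such identities of one-step maps reduce to one analytic fact: on a compact set of
  initial values and for small \<open>h\<close> the stage equations are a contraction, so they have exactly one
  solution in a fixed neighbourhood, and this is the solution that \<open>internal_stages\<close> selects
  (\<open>internal_stages_solve\<close>, \<open>rk_map_eqI\<close>).

  The scheme at \<open>\<alpha> = sqrt 3 / 6\<close> is symplectic because its coefficients satisfy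
  \<open>b i * b j = b i * a i j + b j * a j i\<close>. The one-step map is differentiable, and its Jacobian is obtained by
  differentiating the stage equations (\<open>rk_map_has_jacobian\<close>), so it is the method applied to the
  linearized equation. The matrix of the linearized equation is \<open>J\<close> times a symmetric Hessian,
  the symplectic form is an invariant of the linearized flow, and a method whose coefficients satisfy
  the condition transports quadratic invariants (\<open>omega_preserved\<close>, \<open>symplectic_condition_sufficient\<close>).

  For the converse, a polynomial Hamiltonian with two degrees of freedom is constructed
  for which the linearized stage equations, for suitable initial values, involve
  only the first stage of the scheme. The Jacobian is then explicit, and it is
  symplectic only if \<open>b 1 * (b 1 - 2 * a 1 1) = 0\<close>
  (\<open>symplectic_imp_diagonal_defect_zero\<close>). Since \<open>b 1 = 1 / (24 * \<alpha>\<^sup>2)\<close> is not 0 and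
  \<open>b 1 - 2 * a 1 1 = 3/2 * \<alpha> - 1 / (8 * \<alpha>)\<close>, this forces \<open>\<alpha>\<^sup>2 = 1/12\<close>.
  A quadratic Hamiltonian could not show this: the scheme is symmetric, so its stability function
  satisfies \<open>R(z) * R(-z) = 1\<close>, and linear Hamiltonian systems are integrated symplectically for every \<open>\<alpha>\<close>.
\<close>

section \<open>Smooth functions on cubes\<close>

text \<open>
  All estimates use the \<open>l1\<close> norm, which turns coordinatewise bounds into sums that can be
  interchanged, and cubes, which are compact and contain with two points every point lying
  coordinatewise between them.
\<close>

definition l1 :: "nat \<Rightarrow> point \<Rightarrow> real" where
  "l1 d v = (\<Sum>k<d. \<bar>v k\<bar>)"

definition cube :: "nat \<Rightarrow> real \<Rightarrow> point set" where
  "cube d R = {x \<in> topspace (Euclidean_space d). \<forall>k<d. \<bar>x k\<bar> \<le> R}"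

lemma l1_nonneg: "0 \<le> l1 d v"
  by (simp add: l1_def sum_nonneg)

lemma abs_le_l1: "k < d \<Longrightarrow> \<bar>v k\<bar> \<le> l1 d v"
  unfolding l1_def by (rule member_le_sum) auto

lemma L2_set_le_l1: "L2_set v {..<d} \<le> l1 d v"
  unfolding l1_def by (rule L2_set_le_sum_abs)

lemma abs_le_L2_set: "(k::nat) < d \<Longrightarrow> \<bar>v k\<bar> \<le> L2_set v {..<d}"
  using member_le_L2_set[OF finite_lessThan, of k d "\<lambda>i. \<bar>v i\<bar>"] by (simp add: L2_set_def)

lemma l1_le_L2_set: "l1 d v \<le> real d * L2_set v {..<d}"
  using sum_bounded_above[of "{..<d}" "\<lambda>k. \<bar>v k\<bar>" "L2_set v {..<d}"]
  by (simp add: l1_def abs_le_L2_set)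

lemma l1_add_le: "l1 d (\<lambda>k. u k + v k) \<le> l1 d u + l1 d v"
  unfolding l1_def sum.distrib[symmetric] by (intro sum_mono abs_triangle_ineq)

lemma l1_cong: "(\<And>k. k < d \<Longrightarrow> u k = v k) \<Longrightarrow> l1 d u = l1 d v"
  by (simp add: l1_def)

lemma l1_scale: "l1 d (\<lambda>k. c * v k) = \<bar>c\<bar> * l1 d v"
  by (simp add: l1_def abs_mult sum_distrib_left)

lemma topspace_upd: "x \<in> topspace (Euclidean_space d) \<Longrightarrow> i < d \<Longrightarrow> x(i := t) \<in> topspace (Euclidean_space d)"
  by (auto simp: topspace_Euclidean_space)

lemma topspace_eqI:
  "x \<in> topspace (Euclidean_space d) \<Longrightarrow> y \<in> topspace (Euclidean_space d) \<Longrightarrow>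
   (\<And>k. k < d \<Longrightarrow> x k = y k) \<Longrightarrow> x = y"
  by (rule ext) (metis (mono_tags, lifting) mem_Collect_eq not_le topspace_Euclidean_space)

lemma cube_topspace: "x \<in> cube d R \<Longrightarrow> x \<in> topspace (Euclidean_space d)"
  by (simp add: cube_def)

lemma cube_mono: "R \<le> R' \<Longrightarrow> cube d R \<subseteq> cube d R'"
  by (force simp: cube_def)

lemma cube_add:
  assumes "y \<in> cube d R" "x \<in> topspace (Euclidean_space d)" "\<And>k. k < d \<Longrightarrow> \<bar>x k - y k\<bar> \<le> r"
  shows "x \<in> cube d (R + r)"
proof -
  have "\<bar>x k\<bar> \<le> R + r" if "k < d" for k
    using assms(1) assms(3)[OF that] that unfolding cube_def by fastforce
  then show ?thesis using assms(2) by (simp add: cube_def)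
qed

lemma compactin_cube: "compactin (Euclidean_space d) (cube d R)"
proof -
  have "cube d R = PiE UNIV (\<lambda>k. if k < d then {-R..R} else {0})"
  proof (intro equalityI subsetI)
    fix x assume "x \<in> cube d R"
    then show "x \<in> PiE UNIV (\<lambda>k. if k < d then {-R..R} else {0})"
      by (simp add: cube_def topspace_Euclidean_space PiE_iff abs_le_iff) (meson minus_le_iff)
  next
    fix x assume x: "x \<in> PiE UNIV (\<lambda>k. if k < d then {-R..R} else {0})"
    have xk: "x k \<in> (if k < d then {-R..R} else {0})" for k using x by (simp add: PiE_iff)
    have "(k < d \<longrightarrow> \<bar>x k\<bar> \<le> R) \<and> (d \<le> k \<longrightarrow> x k = 0)" for k
      using xk[of k] by (cases "k < d") (simp_all add: abs_le_iff)
    then show "x \<in> cube d R"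
      by (simp add: cube_def topspace_Euclidean_space)
  qed
  moreover have "compactin (powertop_real UNIV) (PiE UNIV (\<lambda>k. if k < d then {-R..R} else {0::real}))"
    unfolding compactin_PiE by auto
  ultimately show ?thesis
    by (auto simp: Euclidean_space_def compactin_subtopology cube_def topspace_Euclidean_space)
qed

lemma compactin_imp_bounded:
  assumes "compactin X K" "continuous_map X euclideanreal F"
  shows "\<exists>B>0. \<forall>x\<in>K. \<bar>F x\<bar> \<le> B"
proof -
  have "compact (F ` K)" using image_compactin[OF assms] by simp
  then show ?thesis using compact_imp_bounded bounded_pos by (metis imageI real_norm_def)
qed

lemma continuous_map_coordinate: "continuous_map (Euclidean_space d) euclideanreal (\<lambda>x. x k)"
  unfolding Euclidean_space_def by (intro continuous_intros) auto

lemma compactin_subset_cube: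
  assumes "compactin (Euclidean_space d) K"
  obtains R where "R > 0" "K \<subseteq> cube d R"
proof -
  obtain B where B: "\<And>k. B k > 0" "\<And>k x. x \<in> K \<Longrightarrow> \<bar>x k\<bar> \<le> B k"
    using compactin_imp_bounded[OF assms continuous_map_coordinate] by metis
  let ?R = "1 + (\<Sum>k<d. B k)"
  have "B k \<le> ?R" if "k < d" for k
    using member_le_sum[of k "{..<d}" B] that B(1) by (force simp: less_imp_le)
  then have "K \<subseteq> cube d ?R"
    using order_trans[OF B(2)] compactin_subset_topspace[OF assms] by (auto simp: cube_def)
  moreover have "?R > 0" using B(1) by (simp add: add_pos_nonneg less_imp_le sum_nonneg)
  ultimately show ?thesis using that by blast
qed

text \<open>
  A neighbourhood in the product topology restricts only finitely many coordinates, and on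
  Euclidean space only the first \<open>d\<close> of them can vary; so continuity has the usual form.
\<close>

lemma continuous_map_imp_eps_delta:
  assumes F: "continuous_map (Euclidean_space d) euclideanreal F"
    and y: "y \<in> topspace (Euclidean_space d)" and e: "\<epsilon> > 0"
  shows "\<exists>\<delta>>0. \<forall>x \<in> topspace (Euclidean_space d).
           (\<forall>k<d. \<bar>x k - y k\<bar> < \<delta>) \<longrightarrow> \<bar>F x - F y\<bar> < \<epsilon>"
proof -
  let ?E = "topspace (Euclidean_space d)"
  define S where "S = {x \<in> ?E. F x \<in> ball (F y) \<epsilon>}"
  have "openin (Euclidean_space d) S"
    unfolding S_def by (rule openin_continuous_map_preimage[OF F]) auto
  then obtain T where T: "openin (powertop_real UNIV) T" "S = T \<inter> ?E"
    unfolding Euclidean_space_def openin_subtopology by auto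
  have "y \<in> S" using y e by (simp add: S_def)
  then have "y \<in> T" using T(2) by blast
  then have "\<exists>U. finite {i \<in> UNIV. U i \<noteq> topspace euclideanreal} \<and>
      (\<forall>i\<in>UNIV. openin euclideanreal (U i)) \<and> y \<in> PiE UNIV U \<and> PiE UNIV U \<subseteq> T"
    using T(1) unfolding openin_product_topology_alt by (rule bspec[rotated])
  then obtain U :: "nat \<Rightarrow> real set"
    where U: "\<And>i. open (U i)" "y \<in> PiE UNIV U" "PiE UNIV U \<subseteq> T"
    by auto
  have "\<exists>r>0. ball (y i) r \<subseteq> U i" for i
    using U(1)[of i] U(2) by (meson PiE_mem UNIV_I open_contains_ball)
  then obtain r where r: "\<And>i. r i > 0" "\<And>i. ball (y i) (r i) \<subseteq> U i" by metis
  \<comment> \<open>The element 1 makes the set nonempty in dimension 0.\<close>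
  define \<delta> where "\<delta> = Min (insert 1 (r ` {..<d}))"
  have "\<delta> > 0" unfolding \<delta>_def using r(1) by (subst Min_gr_iff) auto
  moreover have "\<bar>F x - F y\<bar> < \<epsilon>" if x: "x \<in> ?E" "\<forall>k<d. \<bar>x k - y k\<bar> < \<delta>" for x
  proof -
    have "x i \<in> U i" for i
    proof (cases "i < d")
      case True
      then have "\<delta> \<le> r i" unfolding \<delta>_def by (intro Min_le) auto
      then show ?thesis using x(2) True r(2)[of i] by (force simp: dist_real_def)
    next
      case False
      then have "x i = y i" using x(1) y by (simp add: topspace_Euclidean_space)
      then show ?thesis using U(2) by auto
    qed
    then have "x \<in> T" using U(3) by auto
    then have "x \<in> S" using T(2) x(1) by blast
    then show ?thesis by (simp add: S_def dist_real_def abs_minus_commute)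
  qed
  ultimately show ?thesis by blast
qed

lemma C_diff_imp_continuous: "C_diff k d F \<Longrightarrow> continuous_map (Euclidean_space d) euclideanreal F"
  by (cases k) auto

lemma C_diff_partial_deriv: "C_diff (Suc k) d F \<Longrightarrow> i < d \<Longrightarrow> C_diff k d (partial_deriv i F)"
  by simp

lemma C_diff_has_partial_deriv:
  assumes "C_diff (Suc k) d F" "i < d" "x \<in> topspace (Euclidean_space d)"
  shows "((\<lambda>t. F (x(i := t))) has_real_derivative partial_deriv i F (x(i := t))) (at t)"
proof -
  have "\<forall>z \<in> topspace (Euclidean_space d). (\<lambda>s. F (z(i := s))) differentiable (at (z i))"
    using assms by simp
  from bspec[OF this topspace_upd[OF assms(3,2), of t]]
  have "(\<lambda>s. F ((x(i := t))(i := s))) differentiable (at ((x(i := t)) i))" .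
  then show ?thesis
    by (simp add: partial_deriv_def flip: DERIV_deriv_iff_real_differentiable)
qed

text \<open>
  Changing one of the first \<open>d\<close> coordinates stays in \<open>d\<close>-dimensional space, so all iterated
  partial derivatives depend only on the values there. This matters because \<open>partial_deriv\<close> obeys
  the rules of calculus only where the derivative exists.
\<close>

lemma C_diff_cong:
  assumes "\<And>x. x \<in> topspace (Euclidean_space d) \<Longrightarrow> F x = G x" "C_diff k d F"
  shows "C_diff k d G"
  using assms
proof (induction k arbitrary: F G)
  case 0
  then show ?case by (auto intro: continuous_map_eq)
next
  case (Suc k)
  have line: "(\<lambda>t. F (x(i := t))) = (\<lambda>t. G (x(i := t)))"
    if "i < d" "x \<in> topspace (Euclidean_space d)" for i x
    by (rule ext, rule Suc.prems(1), rule topspace_upd[OF that(2,1)])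
  have "C_diff k d (partial_deriv i G)" if "i < d" for i
  proof (rule Suc.IH)
    show "C_diff k d (partial_deriv i F)" using Suc.prems(2) that by (rule C_diff_partial_deriv)
    show "partial_deriv i F x = partial_deriv i G x" if "x \<in> topspace (Euclidean_space d)" for x
      unfolding partial_deriv_def line[OF \<open>i < d\<close> that] ..
  qed
  moreover have "continuous_map (Euclidean_space d) euclideanreal G"
    using Suc.prems by (auto intro: continuous_map_eq)
  moreover have "(\<lambda>t. G (x(i := t))) differentiable (at (x i))"
    if "i < d" "x \<in> topspace (Euclidean_space d)" for i x
    using Suc.prems(2) that by (simp flip: line)
  ultimately show ?case by simp
qed

lemma C_diff_uminus: "C_diff k d F \<Longrightarrow> C_diff k d (\<lambda>x. - F x)"
proof (induction k arbitrary: F)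
  case 0
  then show ?case by (auto intro: continuous_intros)
next
  case (Suc k)
  have D: "((\<lambda>t. - F (x(i := t))) has_real_derivative - partial_deriv i F x) (at (x i))"
    if "i < d" "x \<in> topspace (Euclidean_space d)" for i x
    using DERIV_minus[OF C_diff_has_partial_deriv[OF Suc.prems that, of "x i"]]
    by (simp only: fun_upd_triv)
  have "C_diff k d (partial_deriv i (\<lambda>x. - F x))" if i: "i < d" for i
  proof (rule C_diff_cong)
    show "C_diff k d (\<lambda>x. - partial_deriv i F x)"
      by (rule Suc.IH[OF C_diff_partial_deriv[OF Suc.prems i]])
    show "- partial_deriv i F x = partial_deriv i (\<lambda>x. - F x) x"
      if "x \<in> topspace (Euclidean_space d)" for x
      using DERIV_imp_deriv[OF D[OF i that]] by (simp add: partial_deriv_def)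
  qed
  moreover have "continuous_map (Euclidean_space d) euclideanreal (\<lambda>x. - F x)"
    using Suc.prems by (auto intro: continuous_intros)
  moreover have "(\<lambda>t. - F (x(i := t))) differentiable (at (x i))"
    if "i < d" "x \<in> topspace (Euclidean_space d)" for i x
    using D[OF that] by (auto simp: real_differentiable_def)
  ultimately show ?case by simp
qed

lemma mean_value_segment:
  fixes g :: "real \<Rightarrow> real"
  assumes "\<And>t. (g has_real_derivative g' t) (at t)"
  shows "\<exists>t. min a b \<le> t \<and> t \<le> max a b \<and> g b - g a = g' t * (b - a)"
proof (rule linorder_cases[of a b])
  assume "a < b"
  then obtain z where "a < z" "z < b" "g b - g a = (b - a) * g' z" using MVT2[of a b g g', OF _ assms] by blast
  then show ?thesis by (intro exI[of _ z]) auto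
next
  assume "b < a"
  then obtain z where "b < z" "z < a" "g a - g b = (a - b) * g' z" using MVT2[of b a g g', OF _ assms] by blast
  then show ?thesis by (intro exI[of _ z]) (auto simp: algebra_simps)
qed auto

text \<open>Passing from \<open>x\<close> to \<open>y\<close> one coordinate at a time gives a mean value theorem without Frechet derivatives.\<close>

lemma mean_value_coordinatewise:
  assumes F: "C_diff (Suc n) d F"
    and x: "x \<in> topspace (Euclidean_space d)" and y: "y \<in> topspace (Euclidean_space d)"
  obtains \<xi> where "\<And>j. j < d \<Longrightarrow> \<xi> j \<in> topspace (Euclidean_space d)"
    "\<And>j k. j < d \<Longrightarrow> min (x k) (y k) \<le> \<xi> j k \<and> \<xi> j k \<le> max (x k) (y k)"
    "F y - F x = (\<Sum>j<d. partial_deriv j F (\<xi> j) * (y j - x j))"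
proof -
  define z where "z j = (\<lambda>k. if k < j then y k else x k)" for j
  have z_top: "z j \<in> topspace (Euclidean_space d)" for j
    using x y by (auto simp: z_def topspace_Euclidean_space)
  have z_Suc: "z (Suc j) = (z j)(j := y j)" for j by (auto simp: z_def)
  have z_x: "(z j)(j := x j) = z j" for j by (auto simp: z_def)
  have "\<exists>\<xi>. \<xi> \<in> topspace (Euclidean_space d) \<and>
          (\<forall>k. min (x k) (y k) \<le> \<xi> k \<and> \<xi> k \<le> max (x k) (y k)) \<and>
          F (z (Suc j)) - F (z j) = partial_deriv j F \<xi> * (y j - x j)" if j: "j < d" for j
  proof -
    obtain t where t: "min (x j) (y j) \<le> t" "t \<le> max (x j) (y j)"
      "F ((z j)(j := y j)) - F ((z j)(j := x j)) = partial_deriv j F ((z j)(j := t)) * (y j - x j)"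
      using mean_value_segment[OF C_diff_has_partial_deriv[OF F j z_top[of j]]] by blast
    have "min (x k) (y k) \<le> ((z j)(j := t)) k \<and> ((z j)(j := t)) k \<le> max (x k) (y k)" for k
      using t(1,2) by (auto simp: z_def)
    then show ?thesis using t(3) topspace_upd[OF z_top j] by (metis z_Suc z_x)
  qed
  then obtain \<xi> where \<xi>: "\<And>j. j < d \<Longrightarrow> \<xi> j \<in> topspace (Euclidean_space d) \<and>
          (\<forall>k. min (x k) (y k) \<le> \<xi> j k \<and> \<xi> j k \<le> max (x k) (y k)) \<and>
          F (z (Suc j)) - F (z j) = partial_deriv j F (\<xi> j) * (y j - x j)" by metis
  have "z d = y" using x y by (auto simp: z_def topspace_Euclidean_space)
  moreover have "z 0 = x" by (simp add: z_def)
  ultimately have "F y - F x = (\<Sum>j<d. F (z (Suc j)) - F (z j))"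
    using sum_lessThan_telescope[of "\<lambda>j. F (z j)" d] by simp
  also have "\<dots> = (\<Sum>j<d. partial_deriv j F (\<xi> j) * (y j - x j))" using \<xi> by (intro sum.cong) auto
  finally show ?thesis using that \<xi> by blast
qed

text \<open>
  Continuous partial derivatives imply Frechet differentiability: in the coordinatewise mean value
  theorem all intermediate points lie near \<open>y\<close>, so each partial derivative may be evaluated at \<open>y\<close>.
\<close>

lemma C1_linear_approx:
  assumes F: "C_diff (Suc n) d F" and y: "y \<in> topspace (Euclidean_space d)" and e: "\<epsilon> > 0"
  shows "\<exists>\<delta>>0. \<forall>x \<in> topspace (Euclidean_space d). (\<forall>k<d. \<bar>x k - y k\<bar> < \<delta>) \<longrightarrow>
     \<bar>F x - F y - (\<Sum>j<d. partial_deriv j F y * (x j - y j))\<bar> \<le> \<epsilon> * l1 d (\<lambda>k. x k - y k)"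
proof -
  let ?E = "topspace (Euclidean_space d)"
  have "\<exists>\<delta>>0. \<forall>x \<in> ?E. (\<forall>k<d. \<bar>x k - y k\<bar> < \<delta>) \<longrightarrow>
          \<bar>partial_deriv j F x - partial_deriv j F y\<bar> < \<epsilon>" if "j < d" for j
    using continuous_map_imp_eps_delta[OF C_diff_imp_continuous[OF C_diff_partial_deriv[OF F that]] y e] .
  then obtain \<delta>' where \<delta>': "\<And>j. j < d \<Longrightarrow> \<delta>' j > 0 \<and> (\<forall>x \<in> ?E. (\<forall>k<d. \<bar>x k - y k\<bar> < \<delta>' j) \<longrightarrow>
          \<bar>partial_deriv j F x - partial_deriv j F y\<bar> < \<epsilon>)" by metis
  define \<delta> where "\<delta> = Min (insert 1 (\<delta>' ` {..<d}))"
  have "\<delta> > 0" unfolding \<delta>_def using \<delta>' by (subst Min_gr_iff) auto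
  have le: "\<delta> \<le> \<delta>' j" if "j < d" for j unfolding \<delta>_def using that by (intro Min_le) auto
  have "\<bar>F x - F y - (\<Sum>j<d. partial_deriv j F y * (x j - y j))\<bar> \<le> \<epsilon> * l1 d (\<lambda>k. x k - y k)"
    if x: "x \<in> ?E" "\<forall>k<d. \<bar>x k - y k\<bar> < \<delta>" for x
  proof -
    obtain \<xi> where \<xi>: "\<And>j. j < d \<Longrightarrow> \<xi> j \<in> ?E"
      "\<And>j k. j < d \<Longrightarrow> min (y k) (x k) \<le> \<xi> j k \<and> \<xi> j k \<le> max (y k) (x k)"
      "F x - F y = (\<Sum>j<d. partial_deriv j F (\<xi> j) * (x j - y j))"
      using mean_value_coordinatewise[OF F y x(1)] by blast
    have near: "\<bar>partial_deriv j F (\<xi> j) - partial_deriv j F y\<bar> \<le> \<epsilon>" if j: "j < d" for j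
    proof -
      have "\<bar>\<xi> j k - y k\<bar> < \<delta>' j" if "k < d" for k
        using \<xi>(2)[OF j, of k] x(2) that le[OF j] by fastforce
      then show ?thesis using \<delta>'[OF j] \<xi>(1)[OF j] by (simp add: less_imp_le)
    qed
    have "\<bar>F x - F y - (\<Sum>j<d. partial_deriv j F y * (x j - y j))\<bar>
        = \<bar>\<Sum>j<d. (partial_deriv j F (\<xi> j) - partial_deriv j F y) * (x j - y j)\<bar>"
      unfolding \<xi>(3) by (simp add: sum_subtractf left_diff_distrib)
    also have "\<dots> \<le> (\<Sum>j<d. \<epsilon> * \<bar>x j - y j\<bar>)"
      using near by (intro order_trans[OF sum_abs] sum_mono) (auto simp: abs_mult intro: mult_right_mono)
    finally show ?thesis by (simp add: l1_def sum_distrib_left)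
  qed
  then show ?thesis using \<open>\<delta> > 0\<close> by blast
qed

text \<open>The mixed second difference is a mixed partial derivative at an intermediate point;
  since it does not depend on the order of the two variables, neither does the derivative.\<close>

lemma second_difference_mean_value:
  assumes F: "C_diff (Suc (Suc n)) d F" and x: "x \<in> topspace (Euclidean_space d)"
    and i: "i < d" and j: "j < d" and ij: "i \<noteq> j" and h: "h > 0"
  shows "\<exists>\<xi> \<in> topspace (Euclidean_space d). (\<forall>k. \<bar>\<xi> k - x k\<bar> \<le> h) \<and>
     F (x(i := x i + h, j := x j + h)) - F (x(j := x j + h)) - F (x(i := x i + h)) + F x
       = partial_deriv j (partial_deriv i F) \<xi> * h\<^sup>2"
proof -
  define g where "g t = F ((x(j := x j + h))(i := t)) - F (x(i := t))" for t
  have "(g has_real_derivative partial_deriv i F ((x(j := x j + h))(i := t)) - partial_deriv i F (x(i := t))) (at t)"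
    for t
    unfolding g_def
    by (intro DERIV_diff C_diff_has_partial_deriv[OF F i] topspace_upd x j)
  from mean_value_segment[of g, OF this, of "x i" "x i + h"]
  obtain s where s: "min (x i) (x i + h) \<le> s" "s \<le> max (x i) (x i + h)"
    and gs: "g (x i + h) - g (x i)
       = (partial_deriv i F ((x(j := x j + h))(i := s)) - partial_deriv i F (x(i := s))) * h"
    by auto
  have swap: "(x(j := u))(i := v) = (x(i := v))(j := u)" for u v by (rule fun_upd_twist[OF ij[symmetric]])
  have xs: "x(i := s) \<in> topspace (Euclidean_space d)" using x i by (rule topspace_upd)
  from mean_value_segment[of "\<lambda>t. partial_deriv i F ((x(i := s))(j := t))",
      OF C_diff_has_partial_deriv[OF C_diff_partial_deriv[OF F i] j xs], of "x j" "x j + h"]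
  obtain t where t: "min (x j) (x j + h) \<le> t" "t \<le> max (x j) (x j + h)"
    and pt: "partial_deriv i F ((x(i := s))(j := x j + h)) - partial_deriv i F ((x(i := s))(j := x j))
       = partial_deriv j (partial_deriv i F) ((x(i := s))(j := t)) * h"
    by auto
  have xj: "(x(i := s))(j := x j) = x(i := s)" using ij by (auto simp: fun_eq_iff)
  have "F (x(i := x i + h, j := x j + h)) - F (x(j := x j + h)) - F (x(i := x i + h)) + F x
      = g (x i + h) - g (x i)"
    unfolding g_def swap fun_upd_triv by simp
  also have "\<dots> = partial_deriv j (partial_deriv i F) ((x(i := s))(j := t)) * h\<^sup>2"
    using gs pt unfolding xj swap by (simp add: power2_eq_square)
  finally have diff: "F (x(i := x i + h, j := x j + h)) - F (x(j := x j + h)) - F (x(i := x i + h)) + F x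
      = partial_deriv j (partial_deriv i F) ((x(i := s))(j := t)) * h\<^sup>2" .
  moreover have "\<bar>((x(i := s))(j := t)) k - x k\<bar> \<le> h" for k
    using s t h by auto
  ultimately show ?thesis using topspace_upd[OF xs j, of t] by blast
qed

lemma partial_deriv_commute:
  assumes F: "C_diff (Suc (Suc n)) d F" and x: "x \<in> topspace (Euclidean_space d)"
    and i: "i < d" and j: "j < d"
  shows "partial_deriv j (partial_deriv i F) x = partial_deriv i (partial_deriv j F) x"
proof (rule ccontr)
  let ?ij = "partial_deriv j (partial_deriv i F)" and ?ji = "partial_deriv i (partial_deriv j F)"
  assume neq: "?ij x \<noteq> ?ji x"
  then have ij: "i \<noteq> j" by auto
  define \<epsilon> where "\<epsilon> = \<bar>?ij x - ?ji x\<bar> / 2"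
  have e: "\<epsilon> > 0" using neq by (simp add: \<epsilon>_def)
  have "continuous_map (Euclidean_space d) euclideanreal ?ij"
       "continuous_map (Euclidean_space d) euclideanreal ?ji"
    by (rule C_diff_imp_continuous[OF C_diff_partial_deriv[OF C_diff_partial_deriv[OF F]]], (rule i j)+)+
  from this[THEN continuous_map_imp_eps_delta, OF x e]
  obtain \<delta>1 \<delta>2 where d: "\<delta>1 > 0" "\<delta>2 > 0"
    and d1: "\<And>z. z \<in> topspace (Euclidean_space d) \<Longrightarrow> (\<forall>k<d. \<bar>z k - x k\<bar> < \<delta>1) \<Longrightarrow> \<bar>?ij z - ?ij x\<bar> < \<epsilon>"
    and d2: "\<And>z. z \<in> topspace (Euclidean_space d) \<Longrightarrow> (\<forall>k<d. \<bar>z k - x k\<bar> < \<delta>2) \<Longrightarrow> \<bar>?ji z - ?ji x\<bar> < \<epsilon>"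
    by metis
  define h where "h = min \<delta>1 \<delta>2 / 2"
  have h: "h > 0" "h < \<delta>1" "h < \<delta>2" using d by (auto simp: h_def)
  obtain \<xi> where \<xi>: "\<xi> \<in> topspace (Euclidean_space d)" "\<And>k. \<bar>\<xi> k - x k\<bar> \<le> h"
    "F (x(i := x i + h, j := x j + h)) - F (x(j := x j + h)) - F (x(i := x i + h)) + F x = ?ij \<xi> * h\<^sup>2"
    using second_difference_mean_value[OF F x i j ij h(1)] by blast
  obtain \<eta> where \<eta>: "\<eta> \<in> topspace (Euclidean_space d)" "\<And>k. \<bar>\<eta> k - x k\<bar> \<le> h"
    "F (x(j := x j + h, i := x i + h)) - F (x(i := x i + h)) - F (x(j := x j + h)) + F x = ?ji \<eta> * h\<^sup>2"
    using second_difference_mean_value[OF F x j i ij[symmetric] h(1)] by blast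
  have "?ij \<xi> * h\<^sup>2 = ?ji \<eta> * h\<^sup>2"
    unfolding \<xi>(3)[symmetric] \<eta>(3)[symmetric] fun_upd_twist[OF ij, of x "x i + h" "x j + h"] by simp
  then have "?ij \<xi> = ?ji \<eta>" using h by simp
  moreover have "\<bar>?ij \<xi> - ?ij x\<bar> < \<epsilon>" 
    by (intro d1 \<xi>(1) allI impI le_less_trans[OF \<xi>(2) h(2)])
  moreover have "\<bar>?ji \<eta> - ?ji x\<bar> < \<epsilon>" 
    by (intro d2 \<eta>(1) allI impI le_less_trans[OF \<eta>(2) h(3)])
  moreover have "\<bar>?ij x - ?ji x\<bar> \<le> \<bar>?ij \<xi> - ?ij x\<bar> + \<bar>?ij \<xi> - ?ji x\<bar>" by linarith
  ultimately show False unfolding \<epsilon>_def by simp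
qed

section \<open>Bounds for a smooth vector field on a cube\<close>

definition jac :: "(point \<Rightarrow> point) \<Rightarrow> point \<Rightarrow> nat \<Rightarrow> nat \<Rightarrow> real" where
  "jac f x k m = partial_deriv m (\<lambda>y. f y k) x"

text \<open>
  The three bounds in \<open>field_bound\<close> are those that make the stage equations, and their linearization,
  a contraction of a ball for small step sizes. Since \<open>L\<close> only has to be large, \<open>1 \<le> L\<close> is included: an error
  term can then be absorbed into a bound that carries the factor \<open>L\<close>.
\<close>

definition field_bound :: "nat \<Rightarrow> (point \<Rightarrow> point) \<Rightarrow> real \<Rightarrow> real \<Rightarrow> bool" where
  "field_bound d f R L \<longleftrightarrow> 1 \<le> L \<and> (\<forall>x \<in> cube d R.
     f x \<in> topspace (Euclidean_space d) \<and> l1 d (f x) \<le> L \<and>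
     (\<forall>y \<in> cube d R. l1 d (\<lambda>k. f x k - f y k) \<le> L * l1 d (\<lambda>k. x k - y k)) \<and>
     (\<forall>v. l1 d (\<lambda>k. \<Sum>m<d. jac f x k m * v m) \<le> L * l1 d v))"

lemma l1_matrix_bound:
  assumes "\<And>k m. k < d \<Longrightarrow> m < d \<Longrightarrow> \<bar>c k m\<bar> \<le> p k m"
  shows "l1 d (\<lambda>k. \<Sum>m<d. c k m * v m) \<le> (\<Sum>k<d. \<Sum>m<d. p k m) * l1 d v"
proof -
  have "l1 d (\<lambda>k. \<Sum>m<d. c k m * v m) \<le> (\<Sum>k<d. \<Sum>m<d. p k m * l1 d v)"
    unfolding l1_def[of d "\<lambda>k. \<Sum>m<d. c k m * v m"]
  proof (intro sum_mono order_trans[OF sum_abs])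
    fix k m assume "k \<in> {..<d}" "m \<in> {..<d}"
    then have km: "k < d" "m < d" by auto
    have "0 \<le> p k m" using assms[OF km] by linarith
    then show "\<bar>c k m * v m\<bar> \<le> p k m * l1 d v"
      unfolding abs_mult using assms[OF km] abs_le_l1[OF km(2)] by (intro mult_mono) auto
  qed
  then show ?thesis by (simp add: sum_distrib_right)
qed

lemma smooth_field_C_diff: "smooth_field d f \<Longrightarrow> k < d \<Longrightarrow> C_diff n d (\<lambda>y. f y k)"
  by (simp add: smooth_field_def smooth_fun_def)

lemma smooth_field_topspace:
  "smooth_field d f \<Longrightarrow> x \<in> topspace (Euclidean_space d) \<Longrightarrow> f x \<in> topspace (Euclidean_space d)"
  by (simp add: smooth_field_def)

text \<open>
  The partial derivatives are bounded on the compact cube, and the coordinatewise mean value theorem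
  turns these bounds into a Lipschitz constant because its intermediate points stay in the cube.
\<close>

lemma field_bound_exists:
  assumes f: "smooth_field d f"
  shows "\<exists>L. field_bound d f R L"
proof -
  note C = smooth_field_C_diff[OF f]
  have "\<exists>B>0. \<forall>x\<in>cube d R. \<bar>jac f x k m\<bar> \<le> B" if "k < d" "m < d" for k m
    unfolding jac_def
    by (rule compactin_imp_bounded[OF compactin_cube
          C_diff_imp_continuous[OF C_diff_partial_deriv[OF C[OF that(1), of "Suc 0"] that(2)]]])
  then obtain p where p: "\<And>k m x. k < d \<Longrightarrow> m < d \<Longrightarrow> x \<in> cube d R \<Longrightarrow> \<bar>jac f x k m\<bar> \<le> p k m"
    and p_pos: "\<And>k m. k < d \<Longrightarrow> m < d \<Longrightarrow> 0 < p k m" by metis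
  have "\<exists>B>0. \<forall>x\<in>cube d R. \<bar>f x k\<bar> \<le> B" if "k < d" for k
    by (rule compactin_imp_bounded[OF compactin_cube C_diff_imp_continuous[OF C[OF that]]])
  then obtain q where q: "\<And>k x. k < d \<Longrightarrow> x \<in> cube d R \<Longrightarrow> \<bar>f x k\<bar> \<le> q k"
    and q_pos: "\<And>k. k < d \<Longrightarrow> 0 < q k" by metis
  define P where "P = (\<Sum>k<d. \<Sum>m<d. p k m)"
  define Q where "Q = (\<Sum>k<d. q k) + 1"
  have P0: "0 \<le> P" unfolding P_def by (intro sum_nonneg less_imp_le p_pos) auto
  have Q1: "1 \<le> Q" using sum_nonneg[of "{..<d}" q] q_pos by (simp add: Q_def less_imp_le)
  have lip: "l1 d (\<lambda>k. f x k - f y k) \<le> P * l1 d (\<lambda>k. x k - y k)"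
    if x: "x \<in> cube d R" and y: "y \<in> cube d R" for x y
  proof -
    have "\<exists>c. \<forall>m<d. \<bar>c m\<bar> \<le> p k m \<and> f x k - f y k = (\<Sum>m<d. c m * (x m - y m))" if k: "k < d" for k
    proof -
      obtain \<xi> where \<xi>: "\<And>j. j < d \<Longrightarrow> \<xi> j \<in> topspace (Euclidean_space d)"
        "\<And>j k. j < d \<Longrightarrow> min (y k) (x k) \<le> \<xi> j k \<and> \<xi> j k \<le> max (y k) (x k)"
        "f x k - f y k = (\<Sum>j<d. partial_deriv j (\<lambda>y. f y k) (\<xi> j) * (x j - y j))"
        by (rule mean_value_coordinatewise[OF C[OF k] cube_topspace[OF y] cube_topspace[OF x]]) blast
      have "\<xi> j \<in> cube d R" if j: "j < d" for j
      proof -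
        have "\<bar>\<xi> j i\<bar> \<le> R" if i: "i < d" for i
        proof -
          have "\<bar>x i\<bar> \<le> R" "\<bar>y i\<bar> \<le> R" using x y i by (auto simp: cube_def)
          then show ?thesis using \<xi>(2)[OF j, of i] by (auto simp: min_def max_def split: if_splits)
        qed
        then show ?thesis using \<xi>(1)[OF j] by (simp add: cube_def)
      qed
      then have "\<forall>m<d. \<bar>partial_deriv m (\<lambda>y. f y k) (\<xi> m)\<bar> \<le> p k m"
        using p[OF k] by (simp add: jac_def)
      then show ?thesis using \<xi>(3) by (intro exI[of _ "\<lambda>m. partial_deriv m (\<lambda>y. f y k) (\<xi> m)"]) simp
    qed
    then obtain c where c: "\<And>k m. k < d \<Longrightarrow> m < d \<Longrightarrow> \<bar>c k m\<bar> \<le> p k m"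
      "\<And>k m. k < d \<Longrightarrow> m < d \<Longrightarrow> f x k - f y k = (\<Sum>m<d. c k m * (x m - y m))" by metis
    have "l1 d (\<lambda>k. f x k - f y k) = l1 d (\<lambda>k. \<Sum>m<d. c k m * (x m - y m))"
      by (rule l1_cong) (use c(2) in blast)
    also have "\<dots> \<le> P * l1 d (\<lambda>k. x k - y k)"
      unfolding P_def by (rule l1_matrix_bound[OF c(1)])
    finally show ?thesis .
  qed
  have larger: "P * l1 d v \<le> (P + Q) * l1 d v" for v
    using Q1 by (intro mult_right_mono l1_nonneg) simp
  have "field_bound d f R (P + Q)"
    unfolding field_bound_def
  proof (intro conjI ballI allI)
    fix x assume x: "x \<in> cube d R"
    show "f x \<in> topspace (Euclidean_space d)"
      by (rule smooth_field_topspace[OF f cube_topspace[OF x]])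
    have "l1 d (f x) \<le> (\<Sum>k<d. q k)" unfolding l1_def using q x by (intro sum_mono) auto
    then have "l1 d (f x) \<le> Q" by (simp add: Q_def)
    then show "l1 d (f x) \<le> P + Q" using P0 by simp
    show "l1 d (\<lambda>k. f x k - f y k) \<le> (P + Q) * l1 d (\<lambda>k. x k - y k)" if "y \<in> cube d R" for y
      using order_trans[OF lip[OF x that] larger] .
    show "l1 d (\<lambda>k. \<Sum>m<d. jac f x k m * v m) \<le> (P + Q) * l1 d v" for v
      using order_trans[OF l1_matrix_bound larger[unfolded P_def]] p[OF _ _ x]
      unfolding P_def by blast
  qed (use P0 Q1 in simp)
  then show ?thesis ..
qed

section \<open>Solving the stage equations\<close>

definition stage_dist :: "nat \<Rightarrow> nat \<Rightarrow> (nat \<Rightarrow> point) \<Rightarrow> (nat \<Rightarrow> point) \<Rightarrow> real" where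
  "stage_dist s d Y Z = (\<Sum>i<s. l1 d (\<lambda>k. Y i k - Z i k))"

lemma stage_dist_nonneg: "0 \<le> stage_dist s d Y Z"
  by (simp add: stage_dist_def sum_nonneg l1_nonneg)

lemma l1_le_stage_dist: "i < s \<Longrightarrow> l1 d (\<lambda>k. Y i k - Z i k) \<le> stage_dist s d Y Z"
  unfolding stage_dist_def by (rule member_le_sum[where f = "\<lambda>i. l1 d (\<lambda>k. Y i k - Z i k)"]) (auto simp: l1_nonneg)

lemma abs_le_stage_dist: "i < s \<Longrightarrow> k < d \<Longrightarrow> \<bar>Y i k - Z i k\<bar> \<le> stage_dist s d Y Z"
  using abs_le_l1[of k d "\<lambda>k. Y i k - Z i k"] l1_le_stage_dist[of i s d Y Z] by linarith

lemma stage_dist_triangle: "stage_dist s d X Z \<le> stage_dist s d X Y + stage_dist s d Y Z"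
proof -
  have "l1 d (\<lambda>k. X i k - Z i k) \<le> l1 d (\<lambda>k. X i k - Y i k) + l1 d (\<lambda>k. Y i k - Z i k)" for i
    using l1_add_le[of d "\<lambda>k. X i k - Y i k" "\<lambda>k. Y i k - Z i k"] by simp
  then show ?thesis unfolding stage_dist_def sum.distrib[symmetric] by (intro sum_mono)
qed

text \<open>
  The infinitely many entries of a family of stages that do not belong to one of the \<open>s\<close> stages or
  \<open>d\<close> coordinates are kept fixed; the remaining ones form a finite-dimensional space.
\<close>

definition stage_ball :: "nat \<Rightarrow> nat \<Rightarrow> real \<Rightarrow> (nat \<Rightarrow> point) \<Rightarrow> (nat \<Rightarrow> point) set" where
  "stage_ball s d r Y0 =
     {Y. stage_dist s d Y Y0 \<le> r \<and> (\<forall>i k. \<not> (i < s \<and> k < d) \<longrightarrow> Y i k = Y0 i k)}"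

text \<open>
  The iterates of a contraction converge in each coordinate by comparison with a geometric series,
  and the limits form the fixed point.
\<close>

lemma contraction_fixpoint:
  fixes T :: "(nat \<Rightarrow> point) \<Rightarrow> nat \<Rightarrow> point"
  assumes out: "\<And>Y i k. Y \<in> stage_ball s d r Y0 \<Longrightarrow> \<not> (i < s \<and> k < d) \<Longrightarrow> T Y i k = Y0 i k"
    and lip: "\<And>Y Z. Y \<in> stage_ball s d r Y0 \<Longrightarrow> Z \<in> stage_ball s d r Y0 \<Longrightarrow> stage_dist s d (T Y) (T Z) \<le> stage_dist s d Y Z / 2"
    and start: "stage_dist s d (T Y0) Y0 \<le> r / 2"
  shows "\<exists>Y \<in> stage_ball s d r Y0. T Y = Y"
proof -
  have r: "0 \<le> r" using start stage_dist_nonneg[of s d "T Y0" Y0] by linarith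
  have Y0: "Y0 \<in> stage_ball s d r Y0" using r by (simp add: stage_ball_def stage_dist_def l1_def)
  have T_B: "T Y \<in> stage_ball s d r Y0" if Y: "Y \<in> stage_ball s d r Y0" for Y
  proof -
    have "stage_dist s d (T Y) Y0 \<le> stage_dist s d (T Y) (T Y0) + stage_dist s d (T Y0) Y0"
      by (rule stage_dist_triangle)
    also have "\<dots> \<le> r / 2 + r / 2"
      using lip[OF Y Y0] start Y by (simp add: stage_ball_def)
    finally show ?thesis using out[OF Y] by (simp add: stage_ball_def)
  qed
  define y where "y n = (T ^^ n) Y0" for n
  have y_Suc: "y (Suc n) = T (y n)" for n by (simp add: y_def)
  have y_B: "y n \<in> stage_ball s d r Y0" for n
    by (induction n) (use Y0 in \<open>simp add: y_def\<close>, simp add: y_Suc T_B)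
  have step: "stage_dist s d (y (Suc n)) (y n) \<le> r * (1/2) ^ n" for n
  proof (induction n)
    case 0
    then show ?case using start r by (simp add: y_def)
  next
    case (Suc n)
    then show ?case using lip[OF y_B[of "Suc n"] y_B[of n]] by (simp add: y_Suc)
  qed
  have "convergent (\<lambda>n. y n i k)" for i k
  proof (cases "i < s \<and> k < d")
    case True
    have "summable (\<lambda>n. y (Suc n) i k - y n i k)"
    proof (rule summable_comparison_test)
      show "\<exists>N. \<forall>n\<ge>N. norm (y (Suc n) i k - y n i k) \<le> r * (1/2) ^ n"
        using abs_le_stage_dist[OF conjunct1[OF True] conjunct2[OF True]] step
        by (metis order_trans real_norm_def)
      show "summable (\<lambda>n. r * (1/2) ^ n)" by (intro summable_mult summable_geometric) simp
    qed
    then have "convergent (\<lambda>n. (\<Sum>m<n. y (Suc m) i k - y m i k) + y 0 i k)"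
      unfolding summable_iff_convergent by (intro convergent_add convergent_const)
    moreover have "(\<Sum>m<n. y (Suc m) i k - y m i k) + y 0 i k = y n i k" for n
      using sum_lessThan_telescope[of "\<lambda>n. y n i k" n] by simp
    ultimately show ?thesis by simp
  next
    case False
    then have "(\<lambda>n. y n i k) = (\<lambda>n. Y0 i k)" using y_B by (auto simp: stage_ball_def)
    then show ?thesis by (simp add: convergent_const)
  qed
  then obtain X where X: "\<And>i k. (\<lambda>n. y n i k) \<longlonglongrightarrow> X i k"
    unfolding convergent_def by metis
  have dist_lim: "(\<lambda>n. stage_dist s d (y n) Z) \<longlonglongrightarrow> stage_dist s d X Z" for Z
    unfolding stage_dist_def l1_def by (intro tendsto_intros X)
  have X_B: "X \<in> stage_ball s d r Y0"
  proof -
    have "stage_dist s d X Y0 \<le> r"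
      by (rule LIMSEQ_le_const2[OF dist_lim]) (use y_B in \<open>auto simp: stage_ball_def\<close>)
    moreover have "X i k = Y0 i k" if "\<not> (i < s \<and> k < d)" for i k
    proof -
      have "(\<lambda>n. y n i k) = (\<lambda>n. Y0 i k)" using y_B that by (auto simp: stage_ball_def)
      then show ?thesis using X[of i k] by (simp add: LIMSEQ_const_iff)
    qed
    ultimately show ?thesis by (simp add: stage_ball_def)
  qed
  have "stage_dist s d X (T X) \<le> stage_dist s d X X / 2"
  proof (rule LIMSEQ_le)
    show "(\<lambda>n. stage_dist s d (y (Suc n)) (T X)) \<longlonglongrightarrow> stage_dist s d X (T X)"
      by (rule LIMSEQ_Suc[OF dist_lim])
    show "(\<lambda>n. stage_dist s d (y n) X / 2) \<longlonglongrightarrow> stage_dist s d X X / 2"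
      by (intro tendsto_intros dist_lim) simp
    show "\<exists>N. \<forall>n\<ge>N. stage_dist s d (y (Suc n)) (T X) \<le> stage_dist s d (y n) X / 2"
      using lip[OF y_B X_B] by (simp add: y_Suc)
  qed
  then have "stage_dist s d X (T X) \<le> 0" by (simp add: stage_dist_def l1_def)
  then have "X i k = T X i k" if "i < s" "k < d" for i k
    using abs_le_stage_dist[OF that, of X "T X"] by simp
  moreover have "T X i k = X i k" if "\<not> (i < s \<and> k < d)" for i k
    using out[OF X_B that] X_B that by (simp add: stage_ball_def)
  ultimately have "T X = X" by (metis ext)
  then show ?thesis using X_B by blast
qed

text \<open>
  The inequality \<open>\<bar>h\<bar> * (rk_size M * L) \<le> 1/2\<close> makes the stage equations a contraction for a field
  bounded by \<open>field_bound\<close> with \<open>L\<close>, and keeps stages and step within distance 1 of the initial value.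
\<close>

definition rk_size :: "rk_tableau \<Rightarrow> real" where
  "rk_size M = ((\<Sum>i<rk_stages M. \<Sum>j<rk_stages M. \<bar>rk_A M ! i ! j\<bar>) + (\<Sum>j<rk_stages M. \<bar>rk_b M ! j\<bar>))
     * (real (rk_stages M) + 1)"

lemma l1_combination:
  fixes s :: nat
  shows "l1 d (\<lambda>k. h * (\<Sum>j<s. w j * V j k)) \<le> \<bar>h\<bar> * (\<Sum>j<s. \<bar>w j\<bar>) * (\<Sum>j<s. l1 d (V j))"
proof -
  have "l1 d (\<lambda>k. \<Sum>j<s. w j * V j k) \<le> (\<Sum>k<d. \<Sum>j<s. \<bar>w j\<bar> * \<bar>V j k\<bar>)"
    unfolding l1_def by (intro sum_mono order_trans[OF sum_abs]) (simp add: abs_mult)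
  also have "\<dots> = (\<Sum>j<s. \<bar>w j\<bar> * l1 d (V j))"
    unfolding l1_def sum_distrib_left by (rule sum.swap)
  also have "\<dots> \<le> (\<Sum>j<s. \<bar>w j\<bar> * (\<Sum>j<s. l1 d (V j)))"
    by (intro sum_mono mult_left_mono member_le_sum[where f = "\<lambda>j. l1 d (V j)"]) (auto simp: l1_nonneg)
  finally have "l1 d (\<lambda>k. \<Sum>j<s. w j * V j k) \<le> (\<Sum>j<s. \<bar>w j\<bar>) * (\<Sum>j<s. l1 d (V j))"
    by (simp only: sum_distrib_right)
  then show ?thesis unfolding l1_scale mult.assoc by (rule mult_left_mono) simp
qed

text \<open>
  The factor \<open>real (rk_stages M) + 1\<close> contained in \<open>rk_size\<close> is kept on the left because bounds on
  single stages enter through a sum over all stages.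
\<close>

lemma stage_combination:
  assumes V: "(\<Sum>j<rk_stages M. l1 d (V j)) \<le> L * c" and h: "\<bar>h\<bar> * (rk_size M * L) \<le> 1/2"
    and L: "0 \<le> L" and c: "0 \<le> c"
  shows "(\<Sum>i<rk_stages M. l1 d (\<lambda>k. h * (\<Sum>j<rk_stages M. rk_A M ! i ! j * V j k))) * (real (rk_stages M) + 1) \<le> c / 2"
    and "l1 d (\<lambda>k. h * (\<Sum>j<rk_stages M. rk_b M ! j * V j k)) * (real (rk_stages M) + 1) \<le> c / 2"
proof -
  let ?s = "rk_stages M"
  let ?A = "\<Sum>i<?s. \<Sum>j<?s. \<bar>rk_A M ! i ! j\<bar>" and ?b = "\<Sum>j<?s. \<bar>rk_b M ! j\<bar>"
  have A0: "0 \<le> ?A" and b0: "0 \<le> ?b" by (intro sum_nonneg; simp)+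
  have key: "\<bar>h\<bar> * w * (\<Sum>j<?s. l1 d (V j)) * (real ?s + 1) \<le> c / 2" if w: "0 \<le> w" "w \<le> ?A + ?b" for w
  proof -
    have "\<bar>h\<bar> * w * (\<Sum>j<?s. l1 d (V j)) * (real ?s + 1) \<le> \<bar>h\<bar> * (?A + ?b) * (L * c) * (real ?s + 1)"
      using w V L c by (intro mult_mono) (auto intro!: sum_nonneg mult_nonneg_nonneg simp: l1_nonneg)
    also have "\<dots> = \<bar>h\<bar> * (rk_size M * L) * c" by (simp add: rk_size_def)
    also have "\<dots> \<le> 1/2 * c" by (rule mult_right_mono[OF h c])
    finally show ?thesis by simp
  qed
  have "(\<Sum>i<?s. l1 d (\<lambda>k. h * (\<Sum>j<?s. rk_A M ! i ! j * V j k)))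
      \<le> (\<Sum>i<?s. \<bar>h\<bar> * (\<Sum>j<?s. \<bar>rk_A M ! i ! j\<bar>) * (\<Sum>j<?s. l1 d (V j)))"
    by (intro sum_mono l1_combination)
  also have "\<dots> = \<bar>h\<bar> * ?A * (\<Sum>j<?s. l1 d (V j))"
    unfolding sum_distrib_right[symmetric] sum_distrib_left[symmetric] ..
  finally have "(\<Sum>i<?s. l1 d (\<lambda>k. h * (\<Sum>j<?s. rk_A M ! i ! j * V j k))) \<le> \<bar>h\<bar> * ?A * (\<Sum>j<?s. l1 d (V j))" .
  then show "(\<Sum>i<?s. l1 d (\<lambda>k. h * (\<Sum>j<?s. rk_A M ! i ! j * V j k))) * (real ?s + 1) \<le> c / 2"
    by (rule order_trans[OF mult_right_mono key]) (use A0 b0 in auto)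
  show "l1 d (\<lambda>k. h * (\<Sum>j<?s. rk_b M ! j * V j k)) * (real ?s + 1) \<le> c / 2"
    by (rule order_trans[OF mult_right_mono[OF l1_combination] key]) (use A0 b0 in auto)
qed

lemma le_mult_stages:
  assumes "0 \<le> x" "x * (real n + 1) \<le> c"
  shows "x \<le> c"
proof -
  have "0 \<le> x * real n" using assms(1) by simp
  then show ?thesis using assms(2) by (simp add: distrib_left)
qed

lemma stage_combination_le:
  assumes "(\<Sum>j<rk_stages M. l1 d (V j)) \<le> L * c" "\<bar>h\<bar> * (rk_size M * L) \<le> 1/2" "0 \<le> L" "0 \<le> c"
  shows "(\<Sum>i<rk_stages M. l1 d (\<lambda>k. h * (\<Sum>j<rk_stages M. rk_A M ! i ! j * V j k))) \<le> c / 2"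
    and "l1 d (\<lambda>k. h * (\<Sum>j<rk_stages M. rk_b M ! j * V j k)) \<le> c / 2"
  using stage_combination[OF assms] le_mult_stages l1_nonneg sum_nonneg
  by (metis (no_types, lifting))+

lemma stage_combination_bounded:
  assumes "\<And>j. j < rk_stages M \<Longrightarrow> l1 d (V j) \<le> L" "\<bar>h\<bar> * (rk_size M * L) \<le> 1/2" "0 \<le> L"
  shows "(\<Sum>i<rk_stages M. l1 d (\<lambda>k. h * (\<Sum>j<rk_stages M. rk_A M ! i ! j * V j k))) \<le> 1 / 2"
    and "l1 d (\<lambda>k. h * (\<Sum>j<rk_stages M. rk_b M ! j * V j k)) \<le> 1 / 2"
proof -
  let ?s = "rk_stages M"
  have "(\<Sum>j<?s. l1 d (V j)) \<le> real ?s * L"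
    using sum_bounded_above[of "{..<?s}" "\<lambda>j. l1 d (V j)" L] assms(1) by simp
  also have "\<dots> \<le> L * (real ?s + 1)" using assms(3) by (simp add: algebra_simps)
  finally have V: "(\<Sum>j<?s. l1 d (V j)) \<le> L * (real ?s + 1)" .
  have *: "x \<le> 1/2" if "x * (real ?s + 1) \<le> (real ?s + 1) / 2" for x
    using that by (intro mult_right_le_imp_le[of x "real ?s + 1" "1/2"]) auto
  show "(\<Sum>i<?s. l1 d (\<lambda>k. h * (\<Sum>j<?s. rk_A M ! i ! j * V j k))) \<le> 1 / 2"
    by (rule *, rule stage_combination(1)[OF V assms(2,3)]) simp
  show "l1 d (\<lambda>k. h * (\<Sum>j<?s. rk_b M ! j * V j k)) \<le> 1 / 2"
    by (rule *, rule stage_combination(2)[OF V assms(2,3)]) simp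
qed

text \<open>
  The stage equations contract the ball of radius 1 around the constant family of stages \<open>y\<close> to itself,
  and this ball lies in the cube that is larger by 1.
\<close>

lemma stages_exist:
  assumes fb: "field_bound d f (R + 1) L" and y: "y \<in> cube d R" and h: "\<bar>h\<bar> * (rk_size M * L) \<le> 1/2"
  obtains Y where "solves_stages M d f h y Y" "\<And>i. i < rk_stages M \<Longrightarrow> Y i \<in> cube d (R + 1)"
    "stage_dist (rk_stages M) d Y (\<lambda>_. y) \<le> 1"
proof -
  let ?s = "rk_stages M" and ?a = "\<lambda>i j. rk_A M ! i ! j"
  have L: "0 \<le> L" using fb by (simp add: field_bound_def)
  define T where "T Y = (\<lambda>i k. if i < ?s then y k + h * (\<Sum>j<?s. ?a i j * f (Y j) k) else y k)" for Y
  have ball: "Y i \<in> cube d (R + 1)" if Y: "Y \<in> stage_ball ?s d 1 (\<lambda>_. y)" and i: "i < ?s" for Y i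
  proof (rule cube_add[OF y])
    show "Y i \<in> topspace (Euclidean_space d)"
      using Y cube_topspace[OF y] by (simp add: stage_ball_def topspace_Euclidean_space)
    show "\<bar>Y i k - y k\<bar> \<le> 1" if "k < d" for k
      using abs_le_stage_dist[OF i that, of Y "\<lambda>_. y"] Y by (simp add: stage_ball_def)
  qed
  have ball_f: "f (Y i) \<in> topspace (Euclidean_space d)" if "Y \<in> stage_ball ?s d 1 (\<lambda>_. y)" "i < ?s" for Y i
    using fb ball[OF that] by (simp add: field_bound_def)
  have "\<exists>Y \<in> stage_ball ?s d 1 (\<lambda>_. y). T Y = Y"
  proof (rule contraction_fixpoint)
    fix Y i k assume Y: "Y \<in> stage_ball ?s d 1 (\<lambda>_. y)" and ik: "\<not> (i < ?s \<and> k < d)"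
    have "f (Y j) k = 0" if "j < ?s" "\<not> k < d" for j
      using ball_f[OF Y that(1)] that(2) by (simp add: topspace_Euclidean_space)
    then show "T Y i k = y k" using ik by (simp add: T_def)
  next
    fix Y Z assume Y: "Y \<in> stage_ball ?s d 1 (\<lambda>_. y)" and Z: "Z \<in> stage_ball ?s d 1 (\<lambda>_. y)"
    have "(\<Sum>j<?s. l1 d (\<lambda>k. f (Y j) k - f (Z j) k)) \<le> (\<Sum>j<?s. L * l1 d (\<lambda>k. Y j k - Z j k))"
      using fb ball[OF Y] ball[OF Z] by (intro sum_mono) (simp add: field_bound_def)
    then have V: "(\<Sum>j<?s. l1 d (\<lambda>k. f (Y j) k - f (Z j) k)) \<le> L * stage_dist ?s d Y Z"
      by (simp add: stage_dist_def sum_distrib_left)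
    have "stage_dist ?s d (T Y) (T Z)
        = (\<Sum>i<?s. l1 d (\<lambda>k. h * (\<Sum>j<?s. ?a i j * (f (Y j) k - f (Z j) k))))"
      unfolding stage_dist_def
      by (intro sum.cong l1_cong) (simp_all add: T_def right_diff_distrib sum_subtractf)
    also have "\<dots> \<le> stage_dist ?s d Y Z / 2"
      by (rule stage_combination_le(1)[OF V h L stage_dist_nonneg])
    finally show "stage_dist ?s d (T Y) (T Z) \<le> stage_dist ?s d Y Z / 2" .
  next
    have "stage_dist ?s d (T (\<lambda>_. y)) (\<lambda>_. y)
        = (\<Sum>i<?s. l1 d (\<lambda>k. h * (\<Sum>j<?s. ?a i j * f y k)))"
      unfolding stage_dist_def by (intro sum.cong l1_cong) (simp_all add: T_def)
    also have "\<dots> \<le> 1/2"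
      using fb y cube_mono[of R "R + 1" d]
      by (intro stage_combination_bounded(1)[OF _ h L]) (auto simp: field_bound_def)
    finally show "stage_dist ?s d (T (\<lambda>_. y)) (\<lambda>_. y) \<le> 1 / 2" .
  qed
  then obtain Y where Y: "Y \<in> stage_ball ?s d 1 (\<lambda>_. y)" "T Y = Y" by blast
  have "solves_stages M d f h y Y"
    unfolding solves_stages_def
  proof (intro allI impI conjI)
    fix i assume i: "i < ?s"
    show "Y i \<in> topspace (Euclidean_space d)" using ball[OF Y(1) i] by (rule cube_topspace)
    have "Y i = T Y i" using Y(2) by simp
    then show "Y i = (\<lambda>k. y k + h * (\<Sum>j<?s. ?a i j * f (Y j) k))" using i by (simp add: T_def)
  qed
  then show ?thesis using that ball[OF Y(1)] Y(1) by (simp add: stage_ball_def)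
qed

text \<open>
  The difference of two solutions is at most half of itself plus a multiple of the difference of
  the initial values. This gives uniqueness as well as the Lipschitz dependence on the initial value that the
  differentiability of the method rests on.
\<close>

lemma stages_lipschitz:
  assumes fb: "field_bound d f R L" and h: "\<bar>h\<bar> * (rk_size M * L) \<le> 1/2"
    and Y: "solves_stages M d f h x Y" "\<And>i. i < rk_stages M \<Longrightarrow> Y i \<in> cube d R"
    and Z: "solves_stages M d f h y Z" "\<And>i. i < rk_stages M \<Longrightarrow> Z i \<in> cube d R"
  shows "stage_dist (rk_stages M) d Y Z \<le> 2 * real (rk_stages M) * l1 d (\<lambda>k. x k - y k)"
proof -
  let ?s = "rk_stages M" and ?a = "\<lambda>i j. rk_A M ! i ! j"
  have L: "0 \<le> L" using fb by (simp add: field_bound_def)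
  have "(\<Sum>j<?s. l1 d (\<lambda>k. f (Y j) k - f (Z j) k)) \<le> (\<Sum>j<?s. L * l1 d (\<lambda>k. Y j k - Z j k))"
    using fb Y(2) Z(2) by (intro sum_mono) (simp add: field_bound_def)
  then have V: "(\<Sum>j<?s. l1 d (\<lambda>k. f (Y j) k - f (Z j) k)) \<le> L * stage_dist ?s d Y Z"
    by (simp add: stage_dist_def sum_distrib_left)
  have "l1 d (\<lambda>k. Y i k - Z i k)
      \<le> l1 d (\<lambda>k. x k - y k) + l1 d (\<lambda>k. h * (\<Sum>j<?s. ?a i j * (f (Y j) k - f (Z j) k)))"
    if i: "i < ?s" for i
  proof -
    have Yi: "Y i = (\<lambda>k. x k + h * (\<Sum>j<?s. ?a i j * f (Y j) k))"
      using Y(1) i unfolding solves_stages_def by blast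
    have Zi: "Z i = (\<lambda>k. y k + h * (\<Sum>j<?s. ?a i j * f (Z j) k))"
      using Z(1) i unfolding solves_stages_def by blast
    have "Y i k - Z i k = (x k - y k) + h * (\<Sum>j<?s. ?a i j * (f (Y j) k - f (Z j) k))" for k
      using fun_cong[OF Yi, of k] fun_cong[OF Zi, of k]
      by (simp add: right_diff_distrib sum_subtractf)
    then have "l1 d (\<lambda>k. Y i k - Z i k)
        = l1 d (\<lambda>k. (x k - y k) + h * (\<Sum>j<?s. ?a i j * (f (Y j) k - f (Z j) k)))"
      by (intro l1_cong)
    also note l1_add_le
    finally show ?thesis .
  qed
  then have "stage_dist ?s d Y Z
      \<le> (\<Sum>i<?s. l1 d (\<lambda>k. x k - y k) + l1 d (\<lambda>k. h * (\<Sum>j<?s. ?a i j * (f (Y j) k - f (Z j) k))))"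
    unfolding stage_dist_def by (intro sum_mono) simp
  also have "\<dots> = real ?s * l1 d (\<lambda>k. x k - y k)
      + (\<Sum>i<?s. l1 d (\<lambda>k. h * (\<Sum>j<?s. ?a i j * (f (Y j) k - f (Z j) k))))"
    by (simp add: sum.distrib)
  also have "\<dots> \<le> real ?s * l1 d (\<lambda>k. x k - y k) + stage_dist ?s d Y Z / 2"
    by (intro add_left_mono stage_combination_le(1)[OF V h L stage_dist_nonneg])
  finally show ?thesis by simp
qed

lemma stages_unique:
  assumes fb: "field_bound d f R L" and h: "\<bar>h\<bar> * (rk_size M * L) \<le> 1/2"
    and Y: "solves_stages M d f h y Y" "\<And>i. i < rk_stages M \<Longrightarrow> Y i \<in> cube d R"
    and Z: "solves_stages M d f h y Z" "\<And>i. i < rk_stages M \<Longrightarrow> Z i \<in> cube d R"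
    and i: "i < rk_stages M"
  shows "Y i = Z i"
proof (rule topspace_eqI[OF cube_topspace[OF Y(2)[OF i]] cube_topspace[OF Z(2)[OF i]]])
  have "stage_dist (rk_stages M) d Y Z \<le> 0"
    using stages_lipschitz[OF fb h Y Z] by (simp add: l1_def)
  then show "Y i k = Z i k" if "k < d" for k
    using abs_le_stage_dist[OF i that, of Y Z] by simp
qed

text \<open>A solution nearest to the initial value is at least as near as the constructed one, so it
  lies in the region where solutions are unique.\<close>

lemma internal_stages_solve:
  assumes fb: "field_bound d f (R + 1) L" and y: "y \<in> cube d R" and h: "\<bar>h\<bar> * (rk_size M * L) \<le> 1/2"
  shows "solves_stages M d f h y (internal_stages M d f h y)"
    and "i < rk_stages M \<Longrightarrow> internal_stages M d f h y i \<in> cube d (R + 1)"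
proof -
  let ?s = "rk_stages M"
  define g where "g Y = (\<Sum>i<?s. L2_set (\<lambda>k. Y i k - y k) {..<d})" for Y :: "nat \<Rightarrow> point"
  obtain Y where Y: "solves_stages M d f h y Y" "\<And>i. i < ?s \<Longrightarrow> Y i \<in> cube d (R + 1)"
    and near: "stage_dist ?s d Y (\<lambda>_. y) \<le> 1"
    using stages_exist[OF fb y h] by blast
  have gY: "g Y \<le> 1"
    using near unfolding g_def stage_dist_def
    by (rule order_trans[rotated]) (intro sum_mono L2_set_le_l1)
  have in_cube: "Z i \<in> cube d (R + 1)" if Z: "solves_stages M d f h y Z" "g Z \<le> 1" and i: "i < ?s" for Z i
  proof (rule cube_add[OF y])
    show "Z i \<in> topspace (Euclidean_space d)" using Z(1) i unfolding solves_stages_def by blast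
    have "L2_set (\<lambda>k. Z i k - y k) {..<d} \<le> g Z"
      unfolding g_def using i
      by (intro member_le_sum[where f = "\<lambda>i. L2_set (\<lambda>k. Z i k - y k) {..<d}"]) auto
    then show "\<bar>Z i k - y k\<bar> \<le> 1" if "k < d" for k
      using abs_le_L2_set[OF that, of "\<lambda>k. Z i k - y k"] Z(2) by linarith
  qed
  have min: "\<not> g Z < g Y" if Z: "solves_stages M d f h y Z" for Z
  proof
    assume less: "g Z < g Y"
    then have "Z i = Y i" if "i < ?s" for i
      using stages_unique[OF fb h Z _ Y that] in_cube[OF Z] gY by simp
    then have "g Z = g Y" by (simp add: g_def)
    then show False using less by simp
  qed
  have "solves_stages M d f h y (arg_min g (solves_stages M d f h y)) \<and>
      (\<forall>i<?s. arg_min g (solves_stages M d f h y) i \<in> cube d (R + 1))"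
  proof (rule arg_minI[where x = Y])
    fix Z assume Z: "solves_stages M d f h y Z"
      "\<forall>W. solves_stages M d f h y W \<longrightarrow> \<not> g W < g Z"
    have "g Z \<le> 1" using Z(2) Y(1) gY by fastforce
    then show "solves_stages M d f h y Z \<and> (\<forall>i<?s. Z i \<in> cube d (R + 1))"
      using Z(1) in_cube by blast
  qed (use Y(1) min in auto)
  moreover have "internal_stages M d f h y = arg_min g (solves_stages M d f h y)"
    unfolding internal_stages_def g_def ..
  ultimately show "solves_stages M d f h y (internal_stages M d f h y)"
    and "i < ?s \<Longrightarrow> internal_stages M d f h y i \<in> cube d (R + 1)"
    by simp_all
qed

lemma internal_stages_eqI:
  assumes fb: "field_bound d f (R + 1) L" and y: "y \<in> cube d R" and h: "\<bar>h\<bar> * (rk_size M * L) \<le> 1/2"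
    and Z: "solves_stages M d f h y Z" "\<And>i. i < rk_stages M \<Longrightarrow> Z i \<in> cube d (R + 1)"
    and i: "i < rk_stages M"
  shows "internal_stages M d f h y i = Z i"
  using stages_unique[OF fb h internal_stages_solve[OF fb y h] Z i] by blast

text \<open>
  One-step maps can be computed from any solution of the stage equations that stays in the cube;
  equality of methods is always shown by exhibiting common stages.
\<close>

lemma rk_map_eqI:
  assumes fb: "field_bound d f (R + 1) L" and y: "y \<in> cube d R" and h: "\<bar>h\<bar> * (rk_size M * L) \<le> 1/2"
    and Z: "solves_stages M d f h y Z" "\<And>i. i < rk_stages M \<Longrightarrow> Z i \<in> cube d (R + 1)"
  shows "rk_map M d f h y = (\<lambda>k. y k + h * (\<Sum>i<rk_stages M. rk_b M ! i * f (Z i) k))"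
proof -
  have "internal_stages M d f h y i = Z i" if "i < rk_stages M" for i
    by (rule internal_stages_eqI[OF fb y h Z that])
  then show ?thesis by (simp add: rk_map_def)
qed

lemma rk_map_in_cube:
  assumes fb: "field_bound d f (R + 1) L" and y: "y \<in> cube d R" and h: "\<bar>h\<bar> * (rk_size M * L) \<le> 1/2"
  shows "rk_map M d f h y \<in> cube d (R + 1)"
proof (rule cube_add[OF y])
  let ?Y = "internal_stages M d f h y" and ?s = "rk_stages M"
  have L: "0 \<le> L" using fb by (simp add: field_bound_def)
  note Y = internal_stages_solve(2)[OF fb y h]
  have "f (?Y i) \<in> topspace (Euclidean_space d)" "l1 d (f (?Y i)) \<le> L" if "i < ?s" for i
    using fb Y[OF that] by (auto simp: field_bound_def)
  note f = this
  show "rk_map M d f h y \<in> topspace (Euclidean_space d)"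
    using f(1) cube_topspace[OF y] by (simp add: rk_map_def topspace_Euclidean_space)
  have "l1 d (\<lambda>k. rk_map M d f h y k - y k) \<le> 1/2"
    using stage_combination_bounded(2)[OF f(2) h L] by (simp add: rk_map_def)
  then show "\<bar>rk_map M d f h y k - y k\<bar> \<le> 1" if "k < d" for k
    using abs_le_l1[OF that, of "\<lambda>k. rk_map M d f h y k - y k"] by linarith
qed

lemma eventually_small_step: "\<forall>\<^sub>F h in nhds 0. \<bar>h\<bar> * (C::real) \<le> 1/2"
proof -
  have "((\<lambda>h. \<bar>h\<bar> * C) \<longlongrightarrow> \<bar>0\<bar> * C) (nhds 0)" by (intro tendsto_intros filterlim_ident)
  then have "\<forall>\<^sub>F h in nhds 0. \<bar>h\<bar> * C < 1/2" by (intro order_tendstoD(2)) auto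
  then show ?thesis by (rule eventually_mono) simp
qed

section \<open>The scheme at \<open>\<alpha> = sqrt 3 / 6\<close>\<close>

text \<open>The middle stage has weight zero and enters no other stage.\<close>

lemma M_scheme_special:
  "M_scheme (sqrt 3 / 6) = \<lparr>
     rk_c = [1/2 - sqrt 3 / 6, 1/2, 1/2 + sqrt 3 / 6],
     rk_A =
      [[1/4, 0, 1/4 - sqrt 3 / 6],
       [1/4 + sqrt 3 / 8, 0, 1/4 - sqrt 3 / 8],
       [1/4 + sqrt 3 / 6, 0, 1/4]],
     rk_b = [1/2, 0, 1/2] \<rparr>"
proof -
  have e16: "1 / (16 * (sqrt 3 / 6)) = sqrt 3 / 8" by (simp add: field_simps)
  have sq: "(sqrt 3 / 6)\<^sup>2 = 1/12" by (simp add: power_divide)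
  show ?thesis unfolding M_scheme_def e16 sq by (simp add: field_simps)
qed

lemma solves_stages_2:
  "rk_stages M = 2 \<Longrightarrow> solves_stages M d f h y Y \<longleftrightarrow>
     (\<forall>i\<in>{0,1}. Y i \<in> topspace (Euclidean_space d) \<and>
       (\<forall>k. Y i k = y k + h * (rk_A M ! i ! 0 * f (Y 0) k + rk_A M ! i ! 1 * f (Y 1) k)))"
  by (auto simp: solves_stages_def numeral_2_eq_2 less_Suc_eq fun_eq_iff lessThan_Suc add.commute)

lemma solves_stages_3:
  "rk_stages M = 3 \<Longrightarrow> solves_stages M d f h y Y \<longleftrightarrow>
     (\<forall>i\<in>{0,1,2}. Y i \<in> topspace (Euclidean_space d) \<and>
       (\<forall>k. Y i k = y k + h * (rk_A M ! i ! 0 * f (Y 0) k + rk_A M ! i ! 1 * f (Y 1) k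
          + rk_A M ! i ! 2 * f (Y 2) k)))"
  by (auto simp: solves_stages_def numeral_3_eq_3 numeral_2_eq_2 less_Suc_eq fun_eq_iff lessThan_Suc algebra_simps)

text \<open>
  The two outer stages of the three-stage scheme solve the stage equations of the Gauss method.
\<close>

lemma M_scheme_special_equivalent: "rk_equivalent (M_scheme (sqrt 3 / 6)) gauss_legendre2"
  unfolding rk_equivalent_def same_one_step_map_def
proof (intro allI impI)
  let ?M = "M_scheme (sqrt 3 / 6)" and ?G = gauss_legendre2
  fix d f K assume f: "smooth_field d f" and K: "compactin (Euclidean_space d) K"
  obtain R where R: "K \<subseteq> cube d R" using compactin_subset_cube[OF K] by blast
  obtain L where fb: "field_bound d f (R + 1) L" using field_bound_exists[OF f] by blast
  show "\<forall>\<^sub>F h in nhds 0. \<forall>y\<in>K. rk_map ?M d f h y = rk_map ?G d f h y"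
    using eventually_small_step[of "rk_size ?M * L"] eventually_small_step[of "rk_size ?G * L"]
  proof eventually_elim
    case (elim h)
    show ?case
    proof
      fix y assume "y \<in> K"
      then have y: "y \<in> cube d R" using R by blast
      define Y where "Y = internal_stages ?M d f h y"
      note Y_sol = internal_stages_solve(1)[OF fb y elim(1), folded Y_def]
      note Y_cube = internal_stages_solve(2)[OF fb y elim(1), folded Y_def]
      have G: "solves_stages ?G d f h y (\<lambda>i. if i = 0 then Y 0 else Y 2)"
        using Y_sol
        by (simp add: solves_stages_2 solves_stages_3 M_scheme_special gauss_legendre2_def)
      have "rk_map ?M d f h y = (\<lambda>k. y k + h * (1/2 * f (Y 0) k + 1/2 * f (Y 2) k))"
        unfolding rk_map_def Y_def[symmetric]
        by (simp add: M_scheme_special numeral_3_eq_3 numeral_2_eq_2 lessThan_Suc algebra_simps)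
      moreover have "rk_map ?G d f h y = (\<lambda>k. y k + h * (1/2 * f (Y 0) k + 1/2 * f (Y 2) k))"
        using rk_map_eqI[OF fb y elim(2) G] Y_cube
        by (simp add: M_scheme_special gauss_legendre2_def numeral_2_eq_2 lessThan_Suc algebra_simps)
      ultimately show "rk_map ?M d f h y = rk_map ?G d f h y" by simp
    qed
  qed
qed

text \<open>
  Both half steps have the outer stages of the full step as their own stages. For the first half step
  this is so because half of its matrix is the Gauss matrix; for the second one, because half of its
  matrix is the Gauss matrix with half of the weights of the first method subtracted from each row,
  which accounts for the different starting point. The two weight vectors add up to \<open>(1, 1)\<close>.
\<close>

lemma M_scheme_special_composition:
  "same_one_step_map (rk_map (M_scheme (sqrt 3 / 6)))
     (\<lambda>d f h. rk_map Psi_scheme d f (h / 2) \<circ> rk_map Phi_scheme d f (h / 2))"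
  unfolding same_one_step_map_def
proof (intro allI impI)
  let ?M = "M_scheme (sqrt 3 / 6)"
  fix d f K assume f: "smooth_field d f" and K: "compactin (Euclidean_space d) K"
  obtain R where R: "K \<subseteq> cube d R" using compactin_subset_cube[OF K] by blast
  obtain L where fb: "field_bound d f (R + 1) L" using field_bound_exists[OF f] by blast
  \<comment> \<open>The second half step starts in the larger cube.\<close>
  obtain L' where fb': "field_bound d f ((R + 1) + 1) L'" using field_bound_exists[OF f] by blast
  show "\<forall>\<^sub>F h in nhds 0. \<forall>y\<in>K. rk_map ?M d f h y
      = (rk_map Psi_scheme d f (h / 2) \<circ> rk_map Phi_scheme d f (h / 2)) y"
    using eventually_small_step[of "rk_size ?M * L"] eventually_small_step[of "rk_size Phi_scheme * L / 2"]
      eventually_small_step[of "rk_size Psi_scheme * L' / 2"]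
  proof eventually_elim
    case (elim h)
    have Phi: "\<bar>h / 2\<bar> * (rk_size Phi_scheme * L) \<le> 1/2" using elim(2) by simp
    have Psi: "\<bar>h / 2\<bar> * (rk_size Psi_scheme * L') \<le> 1/2" using elim(3) by simp
    show ?case
    proof
      fix y assume "y \<in> K"
      then have y: "y \<in> cube d R" using R by blast
      define Y where "Y = internal_stages ?M d f h y"
      note Y_sol = internal_stages_solve(1)[OF fb y elim(1), folded Y_def]
      note Y_cube = internal_stages_solve(2)[OF fb y elim(1), folded Y_def]
      \<comment> \<open>The common stages of the full step and of both half steps.\<close>
      define Z where "Z i = (if i = 0 then Y 0 else Y 2)" for i :: nat
      have Z_cube: "Z i \<in> cube d (R + 1)" for i
        using Y_cube[of 0] Y_cube[of 2] by (simp add: Z_def M_scheme_special)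
      then have Z_cube': "Z i \<in> cube d ((R + 1) + 1)" for i using cube_mono[of "R + 1" "(R + 1) + 1" d] by auto
      define m where "m = rk_map Phi_scheme d f (h / 2) y"
      have Z_Phi: "solves_stages Phi_scheme d f (h / 2) y Z"
        using Y_sol
        by (simp add: solves_stages_2 solves_stages_3 M_scheme_special Phi_scheme_def Z_def field_simps)
      have m: "m = (\<lambda>k. y k + h / 2 * ((1/2 + sqrt 3 / 4) * f (Y 0) k + (1/2 - sqrt 3 / 4) * f (Y 2) k))"
        using rk_map_eqI[OF fb y Phi Z_Phi Z_cube]
        by (simp add: m_def Phi_scheme_def Z_def numeral_2_eq_2 lessThan_Suc algebra_simps)
      have m_cube: "m \<in> cube d (R + 1)"
        unfolding m_def by (rule rk_map_in_cube[OF fb y Phi])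
      have Y_top: "Y 0 \<in> topspace (Euclidean_space d)" "Y 2 \<in> topspace (Euclidean_space d)"
        and Y0: "Y 0 k = y k + h * (1/4 * f (Y 0) k + (1/4 - sqrt 3 / 6) * f (Y 2) k)"
        and Y2: "Y 2 k = y k + h * ((1/4 + sqrt 3 / 6) * f (Y 0) k + 1/4 * f (Y 2) k)" for k
        using Y_sol by (simp_all add: solves_stages_3 M_scheme_special)
      have "Y 0 k = m k + h / 2 * (- (sqrt 3 / 4) * f (Y 0) k + - (sqrt 3 / 12) * f (Y 2) k)" for k
        unfolding m Y0[of k] by (simp add: field_simps)
      moreover have "Y 2 k = m k + h / 2 * (sqrt 3 / 12 * f (Y 0) k + sqrt 3 / 4 * f (Y 2) k)" for k
        unfolding m Y2[of k] by (simp add: field_simps)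
      ultimately have Z_Psi: "solves_stages Psi_scheme d f (h / 2) m Z"
        using Y_top by (simp add: solves_stages_2 Psi_scheme_def Z_def)
      have "rk_map Psi_scheme d f (h / 2) m = (\<lambda>k. y k + h * (1/2 * f (Y 0) k + 1/2 * f (Y 2) k))"
        unfolding rk_map_eqI[OF fb' m_cube Psi Z_Psi Z_cube']
        by (simp add: fun_eq_iff m Psi_scheme_def Z_def numeral_2_eq_2 lessThan_Suc field_simps)
      moreover have "rk_map ?M d f h y = (\<lambda>k. y k + h * (1/2 * f (Y 0) k + 1/2 * f (Y 2) k))"
        unfolding rk_map_def Y_def[symmetric]
        by (simp add: M_scheme_special numeral_3_eq_3 numeral_2_eq_2 lessThan_Suc algebra_simps)
      ultimately show "rk_map ?M d f h y
          = (rk_map Psi_scheme d f (h / 2) \<circ> rk_map Phi_scheme d f (h / 2)) y"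
        by (simp add: m_def)
    qed
  qed
qed

section \<open>The Jacobian of the one-step map\<close>

lemma smooth_field_linear_approx:
  assumes f: "smooth_field d f" and y: "y \<in> topspace (Euclidean_space d)" and e: "\<epsilon> > 0"
  shows "\<exists>\<delta>>0. \<forall>x \<in> topspace (Euclidean_space d). (\<forall>k<d. \<bar>x k - y k\<bar> < \<delta>) \<longrightarrow>
     l1 d (\<lambda>k. f x k - f y k - (\<Sum>m<d. jac f y k m * (x m - y m))) \<le> \<epsilon> * l1 d (\<lambda>k. x k - y k)"
proof -
  define e' where "e' = \<epsilon> / (real d + 1)"
  have e': "e' > 0" using e by (simp add: e'_def)
  have "\<exists>\<delta>>0. \<forall>x \<in> topspace (Euclidean_space d). (\<forall>i<d. \<bar>x i - y i\<bar> < \<delta>) \<longrightarrow>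
     \<bar>f x k - f y k - (\<Sum>m<d. jac f y k m * (x m - y m))\<bar> \<le> e' * l1 d (\<lambda>k. x k - y k)"
    if k: "k < d" for k
    unfolding jac_def
    by (rule C1_linear_approx[OF smooth_field_C_diff[OF f k, of "Suc 0"] y e'])
  then have "\<forall>k. \<exists>\<delta>. k < d \<longrightarrow> \<delta> > 0 \<and>
    (\<forall>x \<in> topspace (Euclidean_space d). (\<forall>i<d. \<bar>x i - y i\<bar> < \<delta>) \<longrightarrow>
     \<bar>f x k - f y k - (\<Sum>m<d. jac f y k m * (x m - y m))\<bar> \<le> e' * l1 d (\<lambda>k. x k - y k))"
    by blast
  from choice[OF this] obtain \<delta>' where \<delta>': "\<And>k. k < d \<Longrightarrow> \<delta>' k > 0"
    "\<And>k x. k < d \<Longrightarrow> x \<in> topspace (Euclidean_space d) \<Longrightarrow> (\<forall>i<d. \<bar>x i - y i\<bar> < \<delta>' k) \<Longrightarrow>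
     \<bar>f x k - f y k - (\<Sum>m<d. jac f y k m * (x m - y m))\<bar> \<le> e' * l1 d (\<lambda>k. x k - y k)"
    by blast
  define \<delta> where "\<delta> = Min (insert 1 (\<delta>' ` {..<d}))"
  have "\<delta> > 0" unfolding \<delta>_def using \<delta>'(1) by (subst Min_gr_iff) auto
  have le: "\<delta> \<le> \<delta>' k" if "k < d" for k unfolding \<delta>_def using that by (intro Min_le) auto
  have "l1 d (\<lambda>k. f x k - f y k - (\<Sum>m<d. jac f y k m * (x m - y m))) \<le> \<epsilon> * l1 d (\<lambda>k. x k - y k)"
    if x: "x \<in> topspace (Euclidean_space d)" "\<forall>k<d. \<bar>x k - y k\<bar> < \<delta>" for x
  proof -
    let ?c = "l1 d (\<lambda>k. x k - y k)"
    have "\<bar>f x k - f y k - (\<Sum>m<d. jac f y k m * (x m - y m))\<bar> \<le> e' * ?c" if k: "k < d" for k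
    proof (rule \<delta>'(2)[OF k x(1)])
      show "\<forall>i<d. \<bar>x i - y i\<bar> < \<delta>' k" using x(2) le[OF k] by fastforce
    qed
    then have "l1 d (\<lambda>k. f x k - f y k - (\<Sum>m<d. jac f y k m * (x m - y m))) \<le> (\<Sum>k<d. e' * ?c)"
      unfolding l1_def[of d "\<lambda>k. f x k - f y k - (\<Sum>m<d. jac f y k m * (x m - y m))"]
      by (intro sum_mono) simp
    also have "\<dots> = (real d * e') * ?c" by simp
    also have "\<dots> \<le> \<epsilon> * ?c"
      using e by (intro mult_right_mono l1_nonneg) (simp add: e'_def field_simps)
    finally show ?thesis .
  qed
  then show ?thesis using \<open>\<delta> > 0\<close> by blast
qed

text \<open>
  The derivatives \<open>D i\<close> of the stages with respect to the initial value solve the stage equations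
  differentiated formally, and \<open>rk_jacobian\<close> is the formal derivative of the step.
\<close>

definition variational_stages ::
    "rk_tableau \<Rightarrow> nat \<Rightarrow> (point \<Rightarrow> point) \<Rightarrow> real \<Rightarrow> (nat \<Rightarrow> point) \<Rightarrow> (nat \<Rightarrow> nat \<Rightarrow> nat \<Rightarrow> real) \<Rightarrow> bool" where
  "variational_stages M d f h Y D \<longleftrightarrow>
     (\<forall>i<rk_stages M. \<forall>k<d. \<forall>l<d. D i k l = (if k = l then 1 else 0) +
        h * (\<Sum>j<rk_stages M. rk_A M ! i ! j * (\<Sum>m<d. jac f (Y j) k m * D j m l)))"

definition rk_jacobian ::
    "rk_tableau \<Rightarrow> nat \<Rightarrow> (point \<Rightarrow> point) \<Rightarrow> real \<Rightarrow> (nat \<Rightarrow> point) \<Rightarrow> (nat \<Rightarrow> nat \<Rightarrow> nat \<Rightarrow> real) \<Rightarrow> nat \<Rightarrow> nat \<Rightarrow> real" where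
  "rk_jacobian M d f h Y D k l = (if k = l then 1 else 0) +
     h * (\<Sum>j<rk_stages M. rk_b M ! j * (\<Sum>m<d. jac f (Y j) k m * D j m l))"

text \<open>
  The differentiated stage equations are linear with the same contraction constant; they decouple into
  one system for each direction \<open>e\<close>.
\<close>

lemma variational_column_exists:
  assumes fb: "field_bound d f R L" and Y: "\<And>i. i < rk_stages M \<Longrightarrow> Y i \<in> cube d R"
    and h: "\<bar>h\<bar> * (rk_size M * L) \<le> 1/2"
  shows "\<exists>D. \<forall>i<rk_stages M. \<forall>k<d.
    D i k = e k + h * (\<Sum>j<rk_stages M. rk_A M ! i ! j * (\<Sum>m<d. jac f (Y j) k m * D j m))"
proof -
  let ?s = "rk_stages M"
  define T where "T D = (\<lambda>i k. if i < ?s \<and> k < d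
      then e k + h * (\<Sum>j<?s. rk_A M ! i ! j * (\<Sum>m<d. jac f (Y j) k m * D j m)) else e k)" for D
  have L: "0 \<le> L" using fb by (simp add: field_bound_def)
  have "stage_dist ?s d (T D) (T E) \<le> stage_dist ?s d D E / 2" for D E
  proof -
    have "l1 d (\<lambda>k. \<Sum>m<d. jac f (Y j) k m * (D j m - E j m)) \<le> L * l1 d (\<lambda>k. D j k - E j k)" if "j < ?s" for j
      using fb Y[OF that] by (simp add: field_bound_def)
    then have "(\<Sum>j<?s. l1 d (\<lambda>k. \<Sum>m<d. jac f (Y j) k m * (D j m - E j m)))
        \<le> (\<Sum>j<?s. L * l1 d (\<lambda>k. D j k - E j k))"
      by (intro sum_mono) simp
    then have V: "(\<Sum>j<?s. l1 d (\<lambda>k. \<Sum>m<d. jac f (Y j) k m * (D j m - E j m))) \<le> L * stage_dist ?s d D E"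
      by (simp add: stage_dist_def sum_distrib_left)
    have "stage_dist ?s d (T D) (T E) = (\<Sum>i<?s. l1 d (\<lambda>k. h * (\<Sum>j<?s. rk_A M ! i ! j *
        (\<Sum>m<d. jac f (Y j) k m * (D j m - E j m)))))"
      unfolding stage_dist_def
      by (intro sum.cong l1_cong) (simp_all add: T_def right_diff_distrib sum_subtractf)
    also have "\<dots> \<le> stage_dist ?s d D E / 2"
      by (rule stage_combination_le(1)[OF V h L stage_dist_nonneg])
    finally show ?thesis .
  qed
  then have "\<exists>D \<in> stage_ball ?s d (2 * stage_dist ?s d (T (\<lambda>_. e)) (\<lambda>_. e)) (\<lambda>_. e). T D = D"
    by (intro contraction_fixpoint) (auto simp: T_def)
  then obtain D where D: "T D = D" by blast
  have "D i k = e k + h * (\<Sum>j<?s. rk_A M ! i ! j * (\<Sum>m<d. jac f (Y j) k m * D j m))" if "i < ?s" "k < d" for i k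
    using that fun_cong[OF fun_cong[OF D, of i], of k] by (simp add: T_def)
  then show ?thesis by blast
qed

lemma variational_stages_exist:
  assumes fb: "field_bound d f R L" and Y: "\<And>i. i < rk_stages M \<Longrightarrow> Y i \<in> cube d R"
    and h: "\<bar>h\<bar> * (rk_size M * L) \<le> 1/2"
  shows "\<exists>D. variational_stages M d f h Y D"
proof -
  have "\<exists>D. \<forall>i<rk_stages M. \<forall>k<d. D i k = (if k = l then 1 else 0) +
      h * (\<Sum>j<rk_stages M. rk_A M ! i ! j * (\<Sum>m<d. jac f (Y j) k m * D j m))" for l
    by (rule variational_column_exists[OF fb Y h])
  then have "\<forall>l. \<exists>D. \<forall>i<rk_stages M. \<forall>k<d. D i k = (if k = l then 1 else 0) +
      h * (\<Sum>j<rk_stages M. rk_A M ! i ! j * (\<Sum>m<d. jac f (Y j) k m * D j m))" ..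
  from choice[OF this] obtain D where D: "\<And>l. \<forall>i<rk_stages M. \<forall>k<d. D l i k = (if k = l then 1 else 0) +
      h * (\<Sum>j<rk_stages M. rk_A M ! i ! j * (\<Sum>m<d. jac f (Y j) k m * D l j m))"
    by blast
  have "variational_stages M d f h Y (\<lambda>i k l. D l i k)"
    unfolding variational_stages_def using D by blast
  then show ?thesis by (rule exI[of _ "\<lambda>i k l. D l i k"])
qed

lemma variation_apply:
  fixes v :: point
  assumes k: "k < d"
  shows "(\<Sum>l<d. ((if k = l then 1 else 0) + h * (\<Sum>j<s. w j * (\<Sum>m<d. G j k m * D j m l))) * v l)
     = v k + h * (\<Sum>j<(s::nat). w j * (\<Sum>m<d. G j k m * (\<Sum>l<d. D j m l * v l)))"
proof -
  have delta: "(\<Sum>l<d. (if k = l then 1 else 0) * v l) = v k"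
    using k by (simp add: if_distrib[of "\<lambda>c. c * _"] sum.delta' cong: if_cong)
  have "(\<Sum>l<d. (\<Sum>j<s. w j * (\<Sum>m<d. G j k m * D j m l)) * v l)
      = (\<Sum>l<d. \<Sum>j<s. \<Sum>m<d. w j * (G j k m * (D j m l * v l)))"
    by (simp add: sum_distrib_left sum_distrib_right mult.assoc)
  also have "\<dots> = (\<Sum>j<s. \<Sum>l<d. \<Sum>m<d. w j * (G j k m * (D j m l * v l)))" by (rule sum.swap)
  also have "\<dots> = (\<Sum>j<s. \<Sum>m<d. \<Sum>l<d. w j * (G j k m * (D j m l * v l)))"
    by (intro sum.cong refl sum.swap)
  also have "\<dots> = (\<Sum>j<s. w j * (\<Sum>m<d. G j k m * (\<Sum>l<d. D j m l * v l)))"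
    by (simp add: sum_distrib_left)
  finally have rest: "(\<Sum>l<d. (\<Sum>j<s. w j * (\<Sum>m<d. G j k m * D j m l)) * v l)
      = (\<Sum>j<s. w j * (\<Sum>m<d. G j k m * (\<Sum>l<d. D j m l * v l)))" .
  define X where "X l = (\<Sum>j<s. w j * (\<Sum>m<d. G j k m * D j m l))" for l
  have "(\<Sum>l<d. ((if k = l then 1 else 0) + h * X l) * v l) = v k + h * (\<Sum>l<d. X l * v l)"
    unfolding delta[symmetric] distrib_right sum.distrib sum_distrib_left by (simp only: mult.assoc)
  then show ?thesis unfolding X_def rest .
qed

text \<open>
  Differentiability is proved without an implicit function theorem. The error \<open>E\<close> of the linear
  approximation of the stages satisfies the differentiated stage equations up to the remainder \<open>\<rho>\<close> of
  the Taylor expansion of \<open>f\<close> at the stages. By the contraction property \<open>E\<close> is bounded by \<open>\<rho>\<close>, and \<open>\<rho>\<close>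
  is small compared with \<open>x - y\<close> because the stages are Lipschitz in the initial value.
\<close>

lemma rk_map_has_jacobian:
  assumes f: "smooth_field d f" and fb: "field_bound d f (R + 1 + 1) L" and y: "y \<in> cube d R"
    and h: "\<bar>h\<bar> * (rk_size M * L) \<le> 1/2"
    and D: "variational_stages M d f h (internal_stages M d f h y) D"
  shows "has_jacobian d (rk_map M d f h) (rk_jacobian M d f h (internal_stages M d f h y) D) y"
  unfolding has_jacobian_def
proof (intro allI impI)
  fix \<epsilon> :: real assume e: "\<epsilon> > 0"
  let ?s = "rk_stages M" and ?E = "topspace (Euclidean_space d)"
  define Y where "Y = internal_stages M d f h y"
  have L: "1 \<le> L" "0 \<le> L" using fb by (auto simp: field_bound_def)
  have y1: "y \<in> cube d (R + 1)" using y cube_mono[of R "R + 1" d] by auto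
  note Y_sol = internal_stages_solve(1)[OF fb y1 h, folded Y_def]
  note Y_cube = internal_stages_solve(2)[OF fb y1 h, folded Y_def]
  define e' where "e' = \<epsilon> / (2 * real ?s * real d + 1)"
  have "2 * real ?s * real d + 1 > 0" by (intro add_nonneg_pos mult_nonneg_nonneg) auto
  then have e': "e' > 0" "e' * (2 * real ?s * real d) \<le> \<epsilon>"
    using e by (auto simp: e'_def field_simps)
  define \<rho> where "\<rho> z j k = f z k - f (Y j) k - (\<Sum>m<d. jac f (Y j) k m * (z m - Y j m))" for z j k
  have "\<exists>\<delta>>0. \<forall>z \<in> ?E. (\<forall>k<d. \<bar>z k - Y j k\<bar> < \<delta>) \<longrightarrow> l1 d (\<rho> z j) \<le> e' * l1 d (\<lambda>k. z k - Y j k)"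
    if "j < ?s" for j
    unfolding \<rho>_def by (rule smooth_field_linear_approx[OF f cube_topspace[OF Y_cube[OF that]] e'(1)])
  then have "\<forall>j. \<exists>\<delta>. j < ?s \<longrightarrow> \<delta> > 0 \<and>
    (\<forall>z \<in> ?E. (\<forall>k<d. \<bar>z k - Y j k\<bar> < \<delta>) \<longrightarrow> l1 d (\<rho> z j) \<le> e' * l1 d (\<lambda>k. z k - Y j k))"
    by blast
  from choice[OF this] obtain \<delta>' where \<delta>': "\<And>j. j < ?s \<Longrightarrow> \<delta>' j > 0"
    "\<And>j z. j < ?s \<Longrightarrow> z \<in> ?E \<Longrightarrow> (\<forall>k<d. \<bar>z k - Y j k\<bar> < \<delta>' j) \<Longrightarrow>
      l1 d (\<rho> z j) \<le> e' * l1 d (\<lambda>k. z k - Y j k)"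
    by blast
  define \<delta>0 where "\<delta>0 = Min (insert 1 (\<delta>' ` {..<?s}))"
  have d0: "\<delta>0 > 0" unfolding \<delta>0_def using \<delta>'(1) by (subst Min_gr_iff) auto
  have d0_le: "\<delta>0 \<le> \<delta>' j" if "j < ?s" for j unfolding \<delta>0_def using that by (intro Min_le) auto
  \<comment> \<open>The first bound keeps the perturbed initial value in the larger cube, the second one its stages near the old ones.\<close>
  define \<delta> where "\<delta> = min 1 (\<delta>0 / (2 * real ?s * real d + 1))"
  have "\<delta> > 0" using d0 \<open>2 * real ?s * real d + 1 > 0\<close> by (simp add: \<delta>_def)
  moreover have "L2_set (\<lambda>k. rk_map M d f h x k - rk_map M d f h y k
        - (\<Sum>l<d. rk_jacobian M d f h Y D k l * (x l - y l))) {..<d} \<le> \<epsilon> * L2_set (\<lambda>j. x j - y j) {..<d}"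
    if x: "x \<in> ?E" and near: "L2_set (\<lambda>j. x j - y j) {..<d} < \<delta>" for x
  proof -
    let ?n = "L2_set (\<lambda>j. x j - y j) {..<d}"
    have x1: "x \<in> cube d (R + 1)"
    proof (rule cube_add[OF y x])
      show "\<bar>x k - y k\<bar> \<le> 1" if "k < d" for k
        using abs_le_L2_set[OF that, of "\<lambda>k. x k - y k"] near by (simp add: \<delta>_def)
    qed
    define X where "X = internal_stages M d f h x"
    note X_sol = internal_stages_solve(1)[OF fb x1 h, folded X_def]
    note X_cube = internal_stages_solve(2)[OF fb x1 h, folded X_def]
    define v where "v k = x k - y k" for k
    have "stage_dist ?s d X Y \<le> 2 * real ?s * l1 d (\<lambda>k. x k - y k)"
      by (rule stages_lipschitz[OF fb h X_sol X_cube Y_sol Y_cube])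
    also have "\<dots> \<le> 2 * real ?s * (real d * ?n)"
      by (intro mult_left_mono l1_le_L2_set) simp
    finally have dist: "stage_dist ?s d X Y \<le> 2 * real ?s * real d * ?n" by simp
    also have "\<dots> \<le> 2 * real ?s * real d * (\<delta>0 / (2 * real ?s * real d + 1))"
      using near by (intro mult_left_mono) (auto simp: \<delta>_def)
    also have "\<dots> < \<delta>0"
      using d0 \<open>2 * real ?s * real d + 1 > 0\<close> by (simp add: field_simps)
    finally have dist0: "stage_dist ?s d X Y < \<delta>0" .
    have "l1 d (\<rho> (X j) j) \<le> e' * l1 d (\<lambda>k. X j k - Y j k)" if j: "j < ?s" for j
    proof (rule \<delta>'(2)[OF j cube_topspace[OF X_cube[OF j]]], intro allI impI)
      show "\<bar>X j k - Y j k\<bar> < \<delta>' j" if "k < d" for k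
        using abs_le_stage_dist[OF j that, of X Y] dist0 d0_le[OF j] by linarith
    qed
    then have "(\<Sum>j<?s. l1 d (\<rho> (X j) j)) \<le> (\<Sum>j<?s. e' * l1 d (\<lambda>k. X j k - Y j k))"
      by (intro sum_mono) simp
    also have "\<dots> = e' * stage_dist ?s d X Y" by (simp add: stage_dist_def sum_distrib_left)
    also have "\<dots> \<le> e' * (2 * real ?s * real d * ?n)" using dist e'(1) by (intro mult_left_mono) auto
    also have "\<dots> = (e' * (2 * real ?s * real d)) * ?n" by simp
    also have "\<dots> \<le> \<epsilon> * ?n" by (rule mult_right_mono[OF e'(2)]) simp
    finally have P: "(\<Sum>j<?s. l1 d (\<rho> (X j) j)) \<le> \<epsilon> * ?n" .
    define P where "P = (\<Sum>j<?s. l1 d (\<rho> (X j) j))"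
    define E where "E i k = X i k - Y i k - (\<Sum>l<d. D i k l * v l)" for i k
    \<comment> \<open>The error in the value of the field at the j-th stage; it controls both E and the error of the step.\<close>
    define W where "W j k = \<rho> (X j) j k + (\<Sum>m<d. jac f (Y j) k m * E j m)" for j k
    have W_eq: "W j k = f (X j) k - f (Y j) k - (\<Sum>m<d. jac f (Y j) k m * (\<Sum>l<d. D j m l * v l))" for j k
      by (simp add: W_def \<rho>_def E_def right_diff_distrib sum_subtractf)
    have E_eq: "E i k = h * (\<Sum>j<?s. rk_A M ! i ! j * W j k)" if i: "i < ?s" and k: "k < d" for i k
    proof -
      have Xi: "X i = (\<lambda>k. x k + h * (\<Sum>j<?s. rk_A M ! i ! j * f (X j) k))"
        using X_sol i unfolding solves_stages_def by blast
      have Yi: "Y i = (\<lambda>k. y k + h * (\<Sum>j<?s. rk_A M ! i ! j * f (Y j) k))"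
        using Y_sol i unfolding solves_stages_def by blast
      have Di: "D i k l = (if k = l then 1 else 0) +
          h * (\<Sum>j<?s. rk_A M ! i ! j * (\<Sum>m<d. jac f (Y j) k m * D j m l))" if "l < d" for l
        using D i k that by (simp add: variational_stages_def Y_def)
      have "(\<Sum>l<d. D i k l * v l) = (\<Sum>l<d. ((if k = l then 1 else 0) +
          h * (\<Sum>j<?s. rk_A M ! i ! j * (\<Sum>m<d. jac f (Y j) k m * D j m l))) * v l)"
        by (intro sum.cong refl) (simp only: lessThan_iff Di)
      also have "\<dots> = v k + h * (\<Sum>j<?s. rk_A M ! i ! j * (\<Sum>m<d. jac f (Y j) k m * (\<Sum>l<d. D j m l * v l)))"
        by (rule variation_apply[OF k])
      finally show ?thesis
        unfolding E_def W_eq using fun_cong[OF Xi, of k] fun_cong[OF Yi, of k]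
        by (simp add: v_def right_diff_distrib sum_subtractf)
    qed
    have W_l1: "l1 d (W j) \<le> l1 d (\<rho> (X j) j) + L * l1 d (E j)" if j: "j < ?s" for j
    proof -
      have "l1 d (W j) \<le> l1 d (\<rho> (X j) j) + l1 d (\<lambda>k. \<Sum>m<d. jac f (Y j) k m * E j m)"
        unfolding W_def by (rule l1_add_le)
      moreover have "l1 d (\<lambda>k. \<Sum>m<d. jac f (Y j) k m * E j m) \<le> L * l1 d (E j)"
        using fb Y_cube[OF j] by (simp add: field_bound_def)
      ultimately show ?thesis by linarith
    qed
    define E0 where "E0 = (\<Sum>j<?s. l1 d (E j))"
    have nonneg: "0 \<le> P" "0 \<le> E0" by (auto simp: P_def E0_def sum_nonneg l1_nonneg)
    have "(\<Sum>j<?s. l1 d (W j)) \<le> (\<Sum>j<?s. l1 d (\<rho> (X j) j) + L * l1 d (E j))"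
      by (intro sum_mono W_l1) simp
    also have "\<dots> = P + L * E0" by (simp add: sum.distrib P_def E0_def sum_distrib_left)
    also have "\<dots> \<le> L * (P + E0)"
      using mult_right_mono[OF L(1) nonneg(1)] by (simp add: distrib_left)
    finally have W: "(\<Sum>j<?s. l1 d (W j)) \<le> L * (P + E0)" .
    have "E0 = (\<Sum>i<?s. l1 d (\<lambda>k. h * (\<Sum>j<?s. rk_A M ! i ! j * W j k)))"
      unfolding E0_def by (intro sum.cong refl l1_cong E_eq) auto
    also have "\<dots> \<le> (P + E0) / 2"
      by (rule stage_combination_le(1)[OF W h L(2)]) (use nonneg in simp)
    finally have "E0 \<le> P" by simp
    have "l1 d (\<lambda>k. h * (\<Sum>j<?s. rk_b M ! j * W j k)) \<le> (P + E0) / 2"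
      by (rule stage_combination_le(2)[OF W h L(2)]) (use nonneg in simp)
    also have "\<dots> \<le> \<epsilon> * ?n" using \<open>E0 \<le> P\<close> P by (simp add: P_def)
    finally have final: "l1 d (\<lambda>k. h * (\<Sum>j<?s. rk_b M ! j * W j k)) \<le> \<epsilon> * ?n" .
    have "rk_map M d f h x k - rk_map M d f h y k - (\<Sum>l<d. rk_jacobian M d f h Y D k l * (x l - y l))
        = h * (\<Sum>j<?s. rk_b M ! j * W j k)" if k: "k < d" for k
    proof -
      have "(\<Sum>l<d. rk_jacobian M d f h Y D k l * (x l - y l))
          = v k + h * (\<Sum>j<?s. rk_b M ! j * (\<Sum>m<d. jac f (Y j) k m * (\<Sum>l<d. D j m l * v l)))"
        unfolding rk_jacobian_def v_def[symmetric] by (rule variation_apply[OF k])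
      then show ?thesis
        unfolding rk_map_def X_def[symmetric] Y_def[symmetric] W_eq
        by (simp add: v_def right_diff_distrib sum_subtractf)
    qed
    then have "l1 d (\<lambda>k. rk_map M d f h x k - rk_map M d f h y k
        - (\<Sum>l<d. rk_jacobian M d f h Y D k l * (x l - y l))) \<le> \<epsilon> * ?n"
      using final l1_cong by (metis (no_types, lifting))
    then show ?thesis using L2_set_le_l1 order_trans by blast
  qed
  ultimately show "\<exists>\<delta>>0. \<forall>x \<in> ?E. L2_set (\<lambda>j. x j - y j) {..<d} < \<delta> \<longrightarrow>
      L2_set (\<lambda>k. rk_map M d f h x k - rk_map M d f h y k
        - (\<Sum>l<d. rk_jacobian M d f h (internal_stages M d f h y) D k l * (x l - y l))) {..<d}
      \<le> \<epsilon> * L2_set (\<lambda>j. x j - y j) {..<d}"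
    unfolding Y_def by blast
qed

lemma eventually_rk_map_has_jacobian:
  assumes f: "smooth_field d f"
  shows "\<forall>\<^sub>F h in nhds 0. \<forall>y \<in> cube d R.
     solves_stages M d f h y (internal_stages M d f h y) \<and>
     (\<exists>D. variational_stages M d f h (internal_stages M d f h y) D \<and>
       has_jacobian d (rk_map M d f h) (rk_jacobian M d f h (internal_stages M d f h y) D) y)"
proof -
  obtain L where fb: "field_bound d f (R + 1 + 1) L" using field_bound_exists[OF f] by blast
  show ?thesis
    using eventually_small_step[of "rk_size M * L"]
  proof eventually_elim
    case (elim h)
    show ?case
    proof
      fix y assume y: "y \<in> cube d R"
      then have y1: "y \<in> cube d (R + 1)" using cube_mono[of R "R + 1" d] by auto
      obtain D where "variational_stages M d f h (internal_stages M d f h y) D"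
        using variational_stages_exist[where Y = "internal_stages M d f h y", OF fb _ elim]
          internal_stages_solve(2)[OF fb y1 elim] by blast
      then show "solves_stages M d f h y (internal_stages M d f h y) \<and>
         (\<exists>D. variational_stages M d f h (internal_stages M d f h y) D \<and>
           has_jacobian d (rk_map M d f h) (rk_jacobian M d f h (internal_stages M d f h y) D) y)"
        using internal_stages_solve(1)[OF fb y1 elim] rk_map_has_jacobian[OF f fb y elim] by blast
    qed
  qed
qed

lemma has_jacobian_unique:
  assumes S: "has_jacobian d F S y" and S': "has_jacobian d F S' y"
    and y: "y \<in> topspace (Euclidean_space d)" and k: "k < d" and l: "l < d"
  shows "S k l = S' k l"
proof (rule ccontr)
  assume neq: "S k l \<noteq> S' k l"
  define \<epsilon> where "\<epsilon> = \<bar>S k l - S' k l\<bar> / 3"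
  have e: "\<epsilon> > 0" using neq by (simp add: \<epsilon>_def)
  obtain \<delta> where d: "\<delta> > 0" and bd: "\<And>x. x \<in> topspace (Euclidean_space d) \<Longrightarrow> L2_set (\<lambda>j. x j - y j) {..<d} < \<delta> \<Longrightarrow>
        L2_set (\<lambda>i. F x i - F y i - (\<Sum>j<d. S i j * (x j - y j))) {..<d} \<le> \<epsilon> * L2_set (\<lambda>j. x j - y j) {..<d}"
    using S e unfolding has_jacobian_def by blast
  obtain \<delta>' where d': "\<delta>' > 0" and bd': "\<And>x. x \<in> topspace (Euclidean_space d) \<Longrightarrow> L2_set (\<lambda>j. x j - y j) {..<d} < \<delta>' \<Longrightarrow>
        L2_set (\<lambda>i. F x i - F y i - (\<Sum>j<d. S' i j * (x j - y j))) {..<d} \<le> \<epsilon> * L2_set (\<lambda>j. x j - y j) {..<d}"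
    using S' e unfolding has_jacobian_def by blast
  define t where "t = min \<delta> \<delta>' / 2"
  have t: "t > 0" "t < \<delta>" "t < \<delta>'" using d d' by (auto simp: t_def)
  define x where "x = y(l := y l + t)"
  have x: "x \<in> topspace (Euclidean_space d)" unfolding x_def by (rule topspace_upd[OF y l])
  have xy: "x j - y j = (if j = l then t else 0)" for j by (simp add: x_def)
  have "l1 d (\<lambda>j. x j - y j) = t" using l t(1) by (simp add: l1_def xy if_distrib[of abs] sum.delta cong: if_cong)
  then have n: "L2_set (\<lambda>j. x j - y j) {..<d} \<le> t" using L2_set_le_l1 by metis
  have sum_t: "(\<Sum>j<d. A k j * (x j - y j)) = A k l * t" for A :: "nat \<Rightarrow> nat \<Rightarrow> real"
    using l by (simp add: xy if_distrib[of "\<lambda>c. _ * c"] sum.delta cong: if_cong)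
  have et: "\<epsilon> * L2_set (\<lambda>j. x j - y j) {..<d} \<le> \<epsilon> * t" using n e by (intro mult_left_mono) auto
  have "\<bar>F x k - F y k - S k l * t\<bar> \<le> \<epsilon> * t"
    using order_trans[OF abs_le_L2_set[OF k] order_trans[OF bd[OF x] et]] n t by (simp add: sum_t)
  moreover have "\<bar>F x k - F y k - S' k l * t\<bar> \<le> \<epsilon> * t"
    using order_trans[OF abs_le_L2_set[OF k] order_trans[OF bd'[OF x] et]] n t by (simp add: sum_t)
  ultimately have "\<bar>S k l * t - S' k l * t\<bar> \<le> 2 * (\<epsilon> * t)" by linarith
  then have "\<bar>S k l - S' k l\<bar> * t \<le> 2 * \<epsilon> * t"
    using t(1) by (simp add: abs_mult flip: left_diff_distrib)
  then show False using t(1) neq by (simp add: \<epsilon>_def mult_le_0_iff)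
qed

section \<open>The symplecticity condition\<close>

text \<open>
  The symplectic form \<open>u\<^sup>T J v\<close>.
\<close>

definition omega :: "nat \<Rightarrow> point \<Rightarrow> point \<Rightarrow> real" where
  "omega m u v = (\<Sum>k<m. u k * v (k + m) - u (k + m) * v k)"

lemma sum_double: "(\<Sum>k<2 * (m::nat). g k) = (\<Sum>k<m. g k + (g (k + m) :: real))"
proof -
  have "(\<Sum>k<m + n. g k) = (\<Sum>k<m. g k) + (\<Sum>k<n. g (k + m))" for n :: nat
    by (induction n) (simp_all add: add.commute)
  from this[of m] show ?thesis by (simp add: mult_2 sum.distrib)
qed

lemma J_mat_row:
  assumes "k < m"
  shows "(\<Sum>l<2 * m. J_mat m k l * v l) = v (k + m)"
    and "(\<Sum>l<2 * m. J_mat m (k + m) l * v l) = - v k"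
proof -
  have "J_mat m k l * v l = (if l = k + m then v l else 0)" for l
    using assms by (auto simp: J_mat_def)
  then show "(\<Sum>l<2 * m. J_mat m k l * v l) = v (k + m)" using assms by simp
  have "J_mat m (k + m) l * v l = (if l = k then - v l else 0)" for l
    using assms by (auto simp: J_mat_def)
  then show "(\<Sum>l<2 * m. J_mat m (k + m) l * v l) = - v k" using assms by simp
qed

lemma omega_eq_J_mat: "(\<Sum>k<2 * m. \<Sum>l<2 * m. u k * J_mat m k l * v l) = omega m u v"
proof -
  have "(\<Sum>k<2 * m. \<Sum>l<2 * m. u k * J_mat m k l * v l)
      = (\<Sum>k<2 * m. u k * (\<Sum>l<2 * m. J_mat m k l * v l))"
    by (simp add: sum_distrib_left mult.assoc)
  also have "\<dots> = omega m u v"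
    unfolding sum_double[of "\<lambda>k. u k * (\<Sum>l<2 * m. J_mat m k l * v l)"] omega_def
    by (intro sum.cong refl) (simp add: J_mat_row)
  finally show ?thesis .
qed

lemma omega_basis:
  assumes "i < 2 * m" "j < 2 * m"
  shows "omega m (\<lambda>k. if k = i then 1 else 0) (\<lambda>k. if k = j then 1 else 0) = J_mat m i j"
proof -
  have "(\<Sum>l<2 * m. (if k = i then 1 else 0) * J_mat m k l * (if l = j then 1 else 0))
      = (if k = i then J_mat m k j else 0)" for k
    using assms(2) by (simp add: if_distrib[of "\<lambda>c. _ * c"] sum.delta cong: if_cong)
  then show ?thesis
    unfolding omega_eq_J_mat[symmetric] using assms(1) by simp
qed

lemma omega_cong:
  "(\<And>k. k < 2 * m \<Longrightarrow> u k = u' k) \<Longrightarrow> (\<And>k. k < 2 * m \<Longrightarrow> v k = v' k) \<Longrightarrow> omega m u v = omega m u' v'"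
  unfolding omega_def by (intro sum.cong refl) simp

lemma omega_skew: "omega m u v = - omega m v u"
  unfolding omega_def sum_negf[symmetric] by (intro sum.cong refl) (simp add: mult.commute)

lemma omega_combination_left:
  fixes s :: nat
  shows "omega m (\<lambda>k. u k + h * (\<Sum>j<s. w j * U j k)) v = omega m u v + h * (\<Sum>j<s. w j * omega m (U j) v)"
proof -
  define A where "A k = (\<Sum>j<s. w j * U j k)" for k
  have "omega m (\<lambda>k. u k + h * A k) v = omega m u v + h * omega m A v"
    by (simp add: omega_def sum_distrib_left algebra_simps sum_subtractf sum.distrib)
  moreover have "omega m A v = (\<Sum>j<s. w j * omega m (U j) v)"
  proof -
    have "omega m A v = (\<Sum>k<m. \<Sum>j<s. w j * (U j k * v (k + m) - U j (k + m) * v k))"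
      by (simp add: omega_def A_def sum_distrib_right sum_subtractf right_diff_distrib mult.assoc)
    also have "\<dots> = (\<Sum>j<s. w j * omega m (U j) v)"
      unfolding omega_def sum_distrib_left by (rule sum.swap)
    finally show ?thesis .
  qed
  ultimately show ?thesis unfolding A_def by simp
qed

lemma omega_combination_right:
  fixes s :: nat
  shows "omega m u (\<lambda>k. v k + h * (\<Sum>j<s. w j * V j k)) = omega m u v + h * (\<Sum>j<s. w j * omega m u (V j))"
  unfolding omega_skew[of m u] omega_combination_left by (simp add: sum_negf)

text \<open>The quadratic invariant \<open>omega\<close> of the linearized flow is transported by the method: expanding
  \<open>omega\<close> at the new point and eliminating the initial value by means of the stage equations leaves
  only the defects \<open>b i * b j - b i * a i j - b j * a j i\<close>.\<close>

lemma omega_preserved: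
  fixes s :: nat and a :: "nat \<Rightarrow> nat \<Rightarrow> real"
  assumes defect: "\<And>i j. i < s \<Longrightarrow> j < s \<Longrightarrow> b i * b j = b i * a i j + b j * a j i"
    and u: "\<And>i k. i < s \<Longrightarrow> k < 2 * m \<Longrightarrow> u i k = e k + h * (\<Sum>j<s. a i j * U j k)"
    and v: "\<And>i k. i < s \<Longrightarrow> k < 2 * m \<Longrightarrow> v i k = e' k + h * (\<Sum>j<s. a i j * V j k)"
    and skew: "\<And>i. i < s \<Longrightarrow> omega m (U i) (v i) + omega m (u i) (V i) = 0"
  shows "omega m (\<lambda>k. e k + h * (\<Sum>j<s. b j * U j k)) (\<lambda>k. e' k + h * (\<Sum>j<s. b j * V j k)) = omega m e e'"
proof -
  define w where "w i j = omega m (U i) (V j)" for i j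
  have Ue: "omega m (U i) e' = omega m (U i) (v i) - h * (\<Sum>j<s. a i j * w i j)" if i: "i < s" for i
  proof -
    have "omega m (U i) (v i) = omega m (U i) (\<lambda>k. e' k + h * (\<Sum>j<s. a i j * V j k))"
      by (rule omega_cong) (use v[OF i] in auto)
    then show ?thesis unfolding omega_combination_right w_def by simp
  qed
  have eV: "omega m e (V i) = omega m (u i) (V i) - h * (\<Sum>j<s. a i j * w j i)" if i: "i < s" for i
  proof -
    have "omega m (u i) (V i) = omega m (\<lambda>k. e k + h * (\<Sum>j<s. a i j * U j k)) (V i)"
      by (rule omega_cong) (use u[OF i] in auto)
    then show ?thesis unfolding omega_combination_left w_def by simp
  qed
  have sums: "(\<Sum>i<s. b i * omega m e (V i)) + (\<Sum>i<s. b i * omega m (U i) e')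
      = - h * ((\<Sum>i<s. \<Sum>j<s. b i * a i j * w i j) + (\<Sum>i<s. \<Sum>j<s. b i * a i j * w j i))"
  proof -
    have "b i * omega m e (V i) + b i * omega m (U i) e'
        = - h * ((\<Sum>j<s. b i * a i j * w i j) + (\<Sum>j<s. b i * a i j * w j i))" if "i < s" for i
    proof -
      have "omega m e (V i) + omega m (U i) e' = - h * ((\<Sum>j<s. a i j * w i j) + (\<Sum>j<s. a i j * w j i))"
        unfolding Ue[OF that] eV[OF that] using skew[OF that] by (simp add: algebra_simps)
      then have "b i * (omega m e (V i) + omega m (U i) e')
          = b i * (- h * ((\<Sum>j<s. a i j * w i j) + (\<Sum>j<s. a i j * w j i)))" by simp
      then show ?thesis by (simp add: algebra_simps sum_distrib_left)
    qed
    then have "(\<Sum>i<s. b i * omega m e (V i) + b i * omega m (U i) e')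
        = (\<Sum>i<s. - h * ((\<Sum>j<s. b i * a i j * w i j) + (\<Sum>j<s. b i * a i j * w j i)))"
      by (intro sum.cong refl) simp
    then show ?thesis by (simp only: sum.distrib sum_distrib_left[symmetric])
  qed
  have swap: "(\<Sum>i<s. \<Sum>j<s. b i * a i j * w j i) = (\<Sum>i<s. \<Sum>j<s. b j * a j i * w i j)"
    by (rule sum.swap)
  have "(\<Sum>i<s. \<Sum>j<s. b i * b j * w i j) = (\<Sum>i<s. \<Sum>j<s. b i * a i j * w i j + b j * a j i * w i j)"
    by (intro sum.cong refl) (simp add: defect algebra_simps)
  then have quad: "(\<Sum>i<s. \<Sum>j<s. b i * b j * w i j)
      = (\<Sum>i<s. \<Sum>j<s. b i * a i j * w i j) + (\<Sum>i<s. \<Sum>j<s. b i * a i j * w j i)"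
    unfolding swap by (simp only: sum.distrib)
  have "omega m (\<lambda>k. e k + h * (\<Sum>j<s. b j * U j k)) (\<lambda>k. e' k + h * (\<Sum>j<s. b j * V j k))
      = omega m e e' + h * (\<Sum>i<s. b i * omega m e (V i))
        + h * (\<Sum>i<s. b i * (omega m (U i) e' + h * (\<Sum>j<s. b j * w i j)))"
    unfolding omega_combination_left omega_combination_right w_def by simp
  also have "\<dots> = omega m e e' + h * ((\<Sum>i<s. b i * omega m e (V i)) + (\<Sum>i<s. b i * omega m (U i) e'))
        + h * (h * (\<Sum>i<s. \<Sum>j<s. b i * b j * w i j))"
    by (simp add: distrib_left sum.distrib sum_distrib_left mult.left_commute mult.assoc)
  also have "\<dots> = omega m e e'" unfolding sums quad by (simp add: algebra_simps)
  finally show ?thesis .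
qed

lemma hamiltonian_field_components:
  "k < m \<Longrightarrow> hamiltonian_field m H y k = partial_deriv (k + m) H y"
  "k < m \<Longrightarrow> hamiltonian_field m H y (k + m) = - partial_deriv k H y"
  "2 * m \<le> k \<Longrightarrow> hamiltonian_field m H y k = 0"
  unfolding hamiltonian_field_def
  by (simp_all add: J_mat_row) (auto intro!: sum.neutral simp: J_mat_def)

lemma C_diff_hamiltonian_field:
  assumes H: "C_diff (Suc n) (2 * m) H" and k: "k < 2 * m"
  shows "C_diff n (2 * m) (\<lambda>y. hamiltonian_field m H y k)"
proof (cases "k < m")
  case True
  then show ?thesis
    using C_diff_partial_deriv[OF H, of "k + m"] by (simp add: hamiltonian_field_components)
next
  case False
  then obtain i where i: "k = i + m" "i < m" using k by (metis add.commute le_Suc_ex linorder_not_less mult_2 nat_add_left_cancel_less)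
  then show ?thesis
    using C_diff_uminus[OF C_diff_partial_deriv[OF H, of i]] by (simp add: hamiltonian_field_components)
qed

lemma smooth_field_hamiltonian_field:
  assumes "smooth_fun (2 * m) H"
  shows "smooth_field (2 * m) (hamiltonian_field m H)"
  unfolding smooth_field_def smooth_fun_def
proof (intro conjI ballI allI impI)
  show "hamiltonian_field m H y \<in> topspace (Euclidean_space (2 * m))" for y
    by (simp add: topspace_Euclidean_space hamiltonian_field_components(3))
  show "C_diff n (2 * m) (\<lambda>y. hamiltonian_field m H y k)" if "k < 2 * m" for k n
    using C_diff_hamiltonian_field[OF _ that, of n H] assms unfolding smooth_fun_def by blast
qed

lemma jac_hamiltonian_field:
  assumes H: "C_diff (Suc (Suc n)) (2 * m) H" and y: "y \<in> topspace (Euclidean_space (2 * m))"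
    and k: "k < m" and l: "l < 2 * m"
  shows "jac (hamiltonian_field m H) y k l = partial_deriv l (partial_deriv (k + m) H) y"
    and "jac (hamiltonian_field m H) y (k + m) l = - partial_deriv l (partial_deriv k H) y"
proof -
  have k2: "k < 2 * m" using k by simp
  show "jac (hamiltonian_field m H) y k l = partial_deriv l (partial_deriv (k + m) H) y"
    using k by (simp add: jac_def hamiltonian_field_components)
  have "((\<lambda>t. - partial_deriv k H (y(l := t))) has_real_derivative - partial_deriv l (partial_deriv k H) (y(l := y l))) (at (y l))"
    by (rule DERIV_minus[OF C_diff_has_partial_deriv[OF C_diff_partial_deriv[OF H k2] l y]])
  from DERIV_imp_deriv[OF this]
  have "partial_deriv l (\<lambda>y. - partial_deriv k H y) y = - partial_deriv l (partial_deriv k H) y"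
    unfolding partial_deriv_def[of l "\<lambda>y. - partial_deriv k H y"] by (simp only: fun_upd_triv)
  then show "jac (hamiltonian_field m H) y (k + m) l = - partial_deriv l (partial_deriv k H) y"
    using k by (simp add: jac_def hamiltonian_field_components)
qed

text \<open>\<open>jac\<close> of a Hamiltonian field is \<open>J\<close> times the Hessian, so \<open>omega\<close> with one argument multiplied
  by it is the Hessian form up to sign; the symmetry of the Hessian gives the cancellation.\<close>

lemma omega_jac_hamiltonian_field:
  assumes H: "C_diff (Suc (Suc n)) (2 * m) H" and y: "y \<in> topspace (Euclidean_space (2 * m))"
  shows "omega m (\<lambda>k. \<Sum>l<2 * m. jac (hamiltonian_field m H) y k l * u l) v
       + omega m u (\<lambda>k. \<Sum>l<2 * m. jac (hamiltonian_field m H) y k l * v l) = 0"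
proof -
  define q where "q u v = (\<Sum>k<2 * m. \<Sum>l<2 * m. partial_deriv l (partial_deriv k H) y * u l * v k)"
    for u v :: point
  have form: "omega m (\<lambda>k. \<Sum>l<2 * m. jac (hamiltonian_field m H) y k l * u l) v = q u v" for u v
    unfolding q_def sum_double[of "\<lambda>k. \<Sum>l<2 * m. partial_deriv l (partial_deriv k H) y * u l * v k"] omega_def
    by (intro sum.cong refl) (simp add: jac_hamiltonian_field[OF H y] sum_distrib_right sum_negf)
  have "q v u = (\<Sum>l<2 * m. \<Sum>k<2 * m. partial_deriv l (partial_deriv k H) y * v l * u k)"
    unfolding q_def by (rule sum.swap)
  also have "\<dots> = q u v"
    unfolding q_def
    by (intro sum.cong refl) (simp add: partial_deriv_commute[OF H y])
  finally show ?thesis using form[of u v] form[of v u] omega_skew[of m u] by simp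
qed

text \<open>
  The columns of \<open>D i\<close> are the stages of the method applied to the linearized system, so
  \<open>omega_preserved\<close> applies to each pair of columns of the Jacobian; its skewness hypothesis is
  \<open>omega_jac_hamiltonian_field\<close> at the stages.
\<close>

theorem symplectic_condition_sufficient:
  assumes defect: "\<And>i j. i < rk_stages M \<Longrightarrow> j < rk_stages M \<Longrightarrow>
    rk_b M ! i * rk_b M ! j = rk_b M ! i * rk_A M ! i ! j + rk_b M ! j * rk_A M ! j ! i"
  shows "rk_symplectic M"
  unfolding rk_symplectic_def
proof (intro allI impI)
  fix m H K
  assume H: "smooth_fun (2 * m) H" and K: "compactin (Euclidean_space (2 * m)) K"
  let ?f = "hamiltonian_field m H"
  have H2: "C_diff (Suc (Suc 0)) (2 * m) H" using H unfolding smooth_fun_def by blast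
  obtain R where R: "K \<subseteq> cube (2 * m) R" using compactin_subset_cube[OF K] by blast
  show "\<forall>\<^sub>F h in nhds 0. \<forall>y\<in>K. symplectic_at m (rk_map M (2 * m) ?f h) y"
    using eventually_rk_map_has_jacobian[OF smooth_field_hamiltonian_field[OF H], where M = M and R = R]
  proof eventually_elim
    case (elim h)
    show ?case
    proof
      fix y assume "y \<in> K"
      then have y: "y \<in> cube (2 * m) R" using R by blast
      define Y where "Y = internal_stages M (2 * m) ?f h y"
      obtain D where Y: "solves_stages M (2 * m) ?f h y Y"
        and D: "variational_stages M (2 * m) ?f h Y D"
        and S: "has_jacobian (2 * m) (rk_map M (2 * m) ?f h) (rk_jacobian M (2 * m) ?f h Y D) y"
        using elim y unfolding Y_def by blast
      have Y_top: "Y i \<in> topspace (Euclidean_space (2 * m))" if "i < rk_stages M" for i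
        using Y that unfolding solves_stages_def by blast
      have "symplectic_matrix m (rk_jacobian M (2 * m) ?f h Y D)"
        unfolding symplectic_matrix_def omega_eq_J_mat
      proof (intro allI impI)
        fix i j assume ij: "i < 2 * m" "j < 2 * m"
        have column: "D n k l = (if k = l then 1 else 0) + h * (\<Sum>p<rk_stages M. rk_A M ! n ! p *
            (\<Sum>q<2 * m. jac ?f (Y p) k q * D p q l))" if "n < rk_stages M" "k < 2 * m" "l < 2 * m" for n k l
          using D that unfolding variational_stages_def by blast
        have "omega m (\<lambda>k. rk_jacobian M (2 * m) ?f h Y D k i) (\<lambda>k. rk_jacobian M (2 * m) ?f h Y D k j)
            = omega m (\<lambda>k. if k = i then 1 else 0) (\<lambda>k. if k = j then 1 else 0)"
          unfolding rk_jacobian_def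
        proof (rule omega_preserved[where a = "\<lambda>i j. rk_A M ! i ! j"
              and u = "\<lambda>n k. D n k i" and v = "\<lambda>n k. D n k j"])
          show "omega m (\<lambda>k. \<Sum>q<2 * m. jac ?f (Y n) k q * D n q i) (\<lambda>k. D n k j)
              + omega m (\<lambda>k. D n k i) (\<lambda>k. \<Sum>q<2 * m. jac ?f (Y n) k q * D n q j) = 0"
            if "n < rk_stages M" for n
            by (rule omega_jac_hamiltonian_field[OF H2 Y_top[OF that]])
        qed (use defect column ij in auto)
        then show "omega m (\<lambda>k. rk_jacobian M (2 * m) ?f h Y D k i) (\<lambda>k. rk_jacobian M (2 * m) ?f h Y D k j)
            = J_mat m i j"
          using omega_basis[OF ij] by simp
      qed
      then show "symplectic_at m (rk_map M (2 * m) ?f h) y"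
        using S unfolding symplectic_at_def by blast
    qed
  qed
qed

lemma M_scheme_special_symplectic: "rk_symplectic (M_scheme (sqrt 3 / 6))"
  by (rule symplectic_condition_sufficient)
    (auto simp: M_scheme_special less_Suc_eq numeral_3_eq_3 numeral_2_eq_2 field_simps)

section \<open>A Hamiltonian detecting the first diagonal defect\<close>

text \<open>
  Polynomials are closed under partial differentiation at every point of \<open>nat \<Rightarrow> real\<close>, which makes
  them smooth in the iterated sense of \<open>smooth_fun\<close>.
\<close>

inductive polynomial_fun :: "(point \<Rightarrow> real) \<Rightarrow> bool" where
  const: "polynomial_fun (\<lambda>x. c)"
| coordinate: "polynomial_fun (\<lambda>x. x k)"
| add: "polynomial_fun F \<Longrightarrow> polynomial_fun G \<Longrightarrow> polynomial_fun (\<lambda>x. F x + G x)"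
| mult: "polynomial_fun F \<Longrightarrow> polynomial_fun G \<Longrightarrow> polynomial_fun (\<lambda>x. F x * G x)"

lemma polynomial_fun_continuous:
  "polynomial_fun F \<Longrightarrow> continuous_map (Euclidean_space d) euclideanreal F"
  by (induction rule: polynomial_fun.induct) (auto intro!: continuous_intros continuous_map_coordinate)

lemma polynomial_fun_derivative:
  "polynomial_fun F \<Longrightarrow>
   \<exists>F'. polynomial_fun F' \<and> (\<forall>x. ((\<lambda>t. F (x(i := t))) has_real_derivative F' x) (at (x i)))"
proof (induction rule: polynomial_fun.induct)
  case (const c)
  then show ?case by (intro exI[of _ "\<lambda>x. 0"]) (auto intro: polynomial_fun.const)
next
  case (coordinate k)
  have "((\<lambda>t. (x(i := t)) k) has_real_derivative (if k = i then 1 else 0)) (at (x i))" for x :: point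
    by (cases "k = i") auto
  then show ?case by (intro exI[of _ "\<lambda>x. if k = i then 1 else 0"]) (auto intro: polynomial_fun.const)
next
  case (add F G)
  then obtain F' G' where "polynomial_fun F'" "polynomial_fun G'"
    and D: "\<And>x. ((\<lambda>t. F (x(i := t))) has_real_derivative F' x) (at (x i))"
      "\<And>x. ((\<lambda>t. G (x(i := t))) has_real_derivative G' x) (at (x i))" by blast
  then show ?case
    by (intro exI[of _ "\<lambda>x. F' x + G' x"] conjI allI polynomial_fun.add DERIV_add)
next
  case (mult F G)
  then obtain F' G' where P: "polynomial_fun F'" "polynomial_fun G'"
    and D: "\<And>x. ((\<lambda>t. F (x(i := t))) has_real_derivative F' x) (at (x i))"
      "\<And>x. ((\<lambda>t. G (x(i := t))) has_real_derivative G' x) (at (x i))" by blast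
  have "((\<lambda>t. F (x(i := t)) * G (x(i := t))) has_real_derivative F' x * G x + G' x * F x) (at (x i))" for x
    using DERIV_mult[OF D(1)[of x] D(2)[of x]] by (simp only: fun_upd_triv)
  moreover have "polynomial_fun (\<lambda>x. F' x * G x + G' x * F x)"
    using P mult.hyps by (intro polynomial_fun.intros)
  ultimately show ?case by blast
qed

lemma polynomial_fun_C_diff: "polynomial_fun F \<Longrightarrow> C_diff n d F"
proof (induction n arbitrary: F)
  case 0
  then show ?case by (simp add: polynomial_fun_continuous)
next
  case (Suc n)
  have "(\<lambda>t. F (x(i := t))) differentiable (at (x i))" "C_diff n d (partial_deriv i F)" for x i
  proof -
    obtain F' where F': "polynomial_fun F'" "\<And>x. ((\<lambda>t. F (x(i := t))) has_real_derivative F' x) (at (x i))"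
      using polynomial_fun_derivative[OF Suc.prems] by blast
    show "(\<lambda>t. F (x(i := t))) differentiable (at (x i))" using F'(2) by (auto simp: real_differentiable_def)
    have "partial_deriv i F = F'"
      by (rule ext) (simp only: partial_deriv_def DERIV_imp_deriv[OF F'(2)])
    then show "C_diff n d (partial_deriv i F)" using Suc.IH[OF F'(1)] by simp
  qed
  then show ?case using Suc.prems by (simp add: polynomial_fun_continuous)
qed

text \<open>
  With positions \<open>(t, x)\<close> and momenta \<open>(e, p)\<close> the Hamiltonian \<open>e + p * test_rate \<alpha> t x\<close> describes the
  non-autonomous equation \<open>x' = test_rate \<alpha> t x\<close>, \<open>t' = 1\<close>, and its adjoint equation for \<open>p\<close>. The rate is
  designed for three stages with equal \<open>x\<close> and times \<open>- \<alpha> * x\<close>, \<open>0\<close>, \<open>\<alpha> * x\<close>: it vanishes at all of them, so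
  \<open>x\<close> is constant, while its derivative in \<open>x\<close> vanishes at the last two only, where the
  rate is zero for all \<open>x\<close> and has a double zero, respectively. The linearization at this solution is therefore seen by the first stage alone.
  Keeping \<open>x\<close> as a variable lets one fixed Hamiltonian serve all step sizes: the solution
  to be examined for the step size \<open>h\<close> starts at \<open>x = h\<close>.
\<close>

definition test_rate :: "real \<Rightarrow> real \<Rightarrow> real \<Rightarrow> real" where
  "test_rate \<alpha> t x = (\<alpha> * x + t) * t * (\<alpha> * x - t)\<^sup>2"

definition test_rate_x :: "real \<Rightarrow> real \<Rightarrow> real \<Rightarrow> real" where
  "test_rate_x \<alpha> t x = \<alpha> * t * (\<alpha> * x - t)\<^sup>2 + 2 * \<alpha> * (\<alpha> * x + t) * t * (\<alpha> * x - t)"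

definition test_hamiltonian :: "real \<Rightarrow> point \<Rightarrow> real" where
  "test_hamiltonian \<alpha> y = y 2 + y 3 * test_rate \<alpha> (y 0) (y 1)"

lemma smooth_test_hamiltonian: "smooth_fun d (test_hamiltonian \<alpha>)"
proof -
  have "polynomial_fun (\<lambda>y. y 2 + y 3 * ((\<alpha> * y 1 + y 0) * y 0 *
      ((\<alpha> * y 1 + (- 1) * y 0) * (\<alpha> * y 1 + (- 1) * y 0))))"
    by (intro polynomial_fun.intros)
  moreover have "test_hamiltonian \<alpha> = (\<lambda>y. y 2 + y 3 * ((\<alpha> * y 1 + y 0) * y 0 *
      ((\<alpha> * y 1 + (- 1) * y 0) * (\<alpha> * y 1 + (- 1) * y 0))))"
    by (simp add: fun_eq_iff test_hamiltonian_def test_rate_def power2_eq_square)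
  ultimately show ?thesis by (simp add: smooth_fun_def polynomial_fun_C_diff)
qed

lemma DERIV_test_rate: "((\<lambda>x. test_rate \<alpha> t x) has_real_derivative test_rate_x \<alpha> t x) (at x)"
  unfolding test_rate_def test_rate_x_def
  by (auto intro!: derivative_eq_intros simp: algebra_simps power2_eq_square)

lemma partial_deriv_eqI: "((\<lambda>t. F (x(i := t))) has_real_derivative c) (at (x i)) \<Longrightarrow> partial_deriv i F x = c"
  unfolding partial_deriv_def by (rule DERIV_imp_deriv)

abbreviation test_field :: "real \<Rightarrow> point \<Rightarrow> point" where
  "test_field \<alpha> \<equiv> hamiltonian_field 2 (test_hamiltonian \<alpha>)"

lemma test_field_components:
  "test_field \<alpha> y 0 = 1"
  "test_field \<alpha> y 1 = test_rate \<alpha> (y 0) (y 1)"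
  "test_field \<alpha> y 3 = - (y 3 * test_rate_x \<alpha> (y 0) (y 1))"
  "y 3 = 0 \<Longrightarrow> test_field \<alpha> y 2 = 0"
proof -
  have "partial_deriv 2 (test_hamiltonian \<alpha>) y = 1"
    by (rule partial_deriv_eqI) (auto simp: test_hamiltonian_def intro!: derivative_eq_intros)
  then show "test_field \<alpha> y 0 = 1"
    using hamiltonian_field_components(1)[of 0 2] by (simp add: numeral_2_eq_2)
  have "partial_deriv 3 (test_hamiltonian \<alpha>) y = test_rate \<alpha> (y 0) (y 1)"
    by (rule partial_deriv_eqI) (auto simp: test_hamiltonian_def intro!: derivative_eq_intros)
  then show "test_field \<alpha> y 1 = test_rate \<alpha> (y 0) (y 1)"
    using hamiltonian_field_components(1)[of 1 2] by (simp add: numeral_3_eq_3)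
  have "partial_deriv 1 (test_hamiltonian \<alpha>) y = y 3 * test_rate_x \<alpha> (y 0) (y 1)"
    by (rule partial_deriv_eqI) (auto simp: test_hamiltonian_def intro!: derivative_eq_intros DERIV_test_rate)
  then show "test_field \<alpha> y 3 = - (y 3 * test_rate_x \<alpha> (y 0) (y 1))"
    using hamiltonian_field_components(2)[of 1 2] by (simp add: numeral_3_eq_3)
  have "partial_deriv 0 (test_hamiltonian \<alpha>) y = 0" if "y 3 = 0"
    by (rule partial_deriv_eqI) (auto simp: test_hamiltonian_def that)
  then show "y 3 = 0 \<Longrightarrow> test_field \<alpha> y 2 = 0"
    using hamiltonian_field_components(2)[of 0 2] by (simp add: numeral_2_eq_2)
qed

lemma jac_test_field:
  "jac (test_field \<alpha>) y 0 m = 0"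
  "jac (test_field \<alpha>) y 1 1 = test_rate_x \<alpha> (y 0) (y 1)"
  "jac (test_field \<alpha>) y 1 2 = 0"
  "jac (test_field \<alpha>) y 1 3 = 0"
  "y 3 = 0 \<Longrightarrow> m < 3 \<Longrightarrow> jac (test_field \<alpha>) y 3 m = 0"
  "jac (test_field \<alpha>) y 3 3 = - test_rate_x \<alpha> (y 0) (y 1)"
  unfolding jac_def test_field_components
  by (rule partial_deriv_eqI; auto intro!: derivative_eq_intros DERIV_test_rate)+

text \<open>The initial value is chosen such that the times of the three stages are the zeros
  \<open>- \<alpha> * h\<close>, \<open>0\<close>, \<open>\<alpha> * h\<close> of the rate.\<close>

definition test_point :: "real \<Rightarrow> point" where
  "test_point h = (\<lambda>k. if k = 0 then - h / 2 else if k = 1 then h else 0)"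

definition test_stages :: "real \<Rightarrow> real \<Rightarrow> nat \<Rightarrow> point" where
  "test_stages \<alpha> h i = (test_point h)(0 := (real i - 1) * (\<alpha> * h))"

lemma test_field_stages:
  assumes "i < 3"
  shows "test_field \<alpha> (test_stages \<alpha> h i) = (\<lambda>k. if k = 0 then 1 else 0)"
proof
  fix k
  have "test_rate \<alpha> ((real i - 1) * (\<alpha> * h)) h = 0"
    using assms by (auto simp: test_rate_def less_Suc_eq numeral_3_eq_3)
  then have "test_field \<alpha> (test_stages \<alpha> h i) k = (if k = 0 then 1 else 0)" if "k < 4"
    using that test_field_components[where \<alpha> = \<alpha> and y = "test_stages \<alpha> h i"]
    by (auto simp: less_Suc_eq numeral_eq_Suc test_stages_def test_point_def)
  moreover have "test_field \<alpha> (test_stages \<alpha> h i) k = 0" if "4 \<le> k"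
    using that hamiltonian_field_components(3)[of 2 k] by simp
  ultimately show "test_field \<alpha> (test_stages \<alpha> h i) k = (if k = 0 then 1 else 0)"
    by (cases "k < 4") auto
qed

lemma test_stages_solve: "solves_stages (M_scheme \<alpha>) 4 (test_field \<alpha>) h (test_point h) (test_stages \<alpha> h)"
  unfolding solves_stages_def
proof (intro allI impI conjI)
  let ?s = "rk_stages (M_scheme \<alpha>)"
  fix i assume i: "i < ?s"
  have s: "?s = 3" by (simp add: M_scheme_def)
  show "test_stages \<alpha> h i \<in> topspace (Euclidean_space 4)"
    by (simp add: test_stages_def test_point_def topspace_Euclidean_space)
  have c: "(\<Sum>j<?s. rk_A (M_scheme \<alpha>) ! i ! j) = 1/2 + (real i - 1) * \<alpha>"
    using row_sum_condition_M_scheme[of \<alpha>] i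
    by (auto simp: row_sum_condition_def M_scheme_def less_Suc_eq numeral_eq_Suc)
  have "(\<Sum>j<?s. rk_A (M_scheme \<alpha>) ! i ! j * test_field \<alpha> (test_stages \<alpha> h j) k)
      = (if k = 0 then 1/2 + (real i - 1) * \<alpha> else 0)" for k
    unfolding c[symmetric] by (auto simp: test_field_stages s)
  then show "test_stages \<alpha> h i = (\<lambda>k. test_point h k +
      h * (\<Sum>j<?s. rk_A (M_scheme \<alpha>) ! i ! j * test_field \<alpha> (test_stages \<alpha> h j) k))"
    by (auto simp: test_stages_def test_point_def fun_eq_iff algebra_simps)
qed

lemma test_stages_in_cube:
  assumes "\<bar>h\<bar> \<le> 1" "\<bar>h\<bar> * \<bar>\<alpha>\<bar> \<le> 1"
  shows "test_point h \<in> cube 4 1" "i < 3 \<Longrightarrow> test_stages \<alpha> h i \<in> cube 4 2"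
proof -
  show "test_point h \<in> cube 4 1"
    using assms(1) by (auto simp: cube_def topspace_Euclidean_space test_point_def)
  have "\<bar>(real i - 1) * (\<alpha> * h)\<bar> \<le> 2" if "i < 3"
    using that assms(2)
    by (auto simp: less_Suc_eq numeral_3_eq_3 abs_mult mult.commute)
  then show "i < 3 \<Longrightarrow> test_stages \<alpha> h i \<in> cube 4 2"
    using assms(1) by (auto simp: cube_def topspace_Euclidean_space test_point_def test_stages_def)
qed

text \<open>
  A one-stage method with step size 1 and initial value 1 maps the equation \<open>y' = p * y\<close> with stage \<open>x\<close>
  to \<open>1 + b * p * x\<close>, and the adjoint equation \<open>y' = - p * y\<close> with stage \<open>z\<close> to \<open>1 - b * p * z\<close>. These values are
  \<open>(1 + (b - a) * p) / (1 - a * p)\<close> and the same with \<open>- p\<close>, so their product is 1 only for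
  \<open>(b - a)\<^sup>2 = a\<^sup>2\<close>.
\<close>

lemma unit_multipliers_imp:
  fixes a b p x z :: real
  assumes "x = 1 + a * p * x" "z = 1 - a * p * z" "(1 + b * p * x) * (1 - b * p * z) = 1" "p \<noteq> 0"
  shows "b * (b - 2 * a) = 0"
proof -
  have x: "x * (1 - a * p) = 1" and z: "z * (1 + a * p) = 1"
    using assms(1,2) by (simp_all add: algebra_simps)
  have "((1 + b * p * x) * (1 - b * p * z)) * ((1 - a * p) * (1 + a * p))
      = ((1 + b * p * x) * (1 - a * p)) * ((1 - b * p * z) * (1 + a * p))"
    by (simp only: ac_simps)
  then have "(1 - a * p) * (1 + a * p) = ((1 + b * p * x) * (1 - a * p)) * ((1 - b * p * z) * (1 + a * p))"
    unfolding assms(3) by simp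
  also have "(1 + b * p * x) * (1 - a * p) = 1 - a * p + b * p * (x * (1 - a * p))" by (simp add: algebra_simps)
  also have "(1 - b * p * z) * (1 + a * p) = 1 + a * p - b * p * (z * (1 + a * p))" by (simp add: algebra_simps)
  finally have "p\<^sup>2 * (b * (b - 2 * a)) = 0"
    unfolding x z by (simp add: algebra_simps power2_eq_square)
  then show ?thesis using assms(4) by simp
qed

lemma sum_lessThan_3: "(\<Sum>j<3. g j) = g 0 + g 1 + (g (2::nat) :: real)"
  by (simp add: numeral_eq_Suc)

lemma sum_lessThan_4: "(\<Sum>j<4. g j) = g 0 + g 1 + g 2 + (g (3::nat) :: real)"
  by (simp add: numeral_eq_Suc)

text \<open>
  Along the test stages the variations of \<open>x\<close> and \<open>p\<close> decouple and only the first stage contributes, so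
  the \<open>x\<close> and \<open>p\<close> rows reduce to one-stage methods for adjoint scalar equations with matrix \<open>a\<close> and
  weight \<open>b\<close>. The columns 1 and 3 are those of the conjugate variables \<open>x\<close> and \<open>p\<close>.
\<close>

lemma test_jacobian:
  fixes \<alpha> h :: real
  defines "a \<equiv> rk_A (M_scheme \<alpha>) ! 0 ! 0" and "b \<equiv> rk_b (M_scheme \<alpha>) ! 0"
    and "S \<equiv> rk_jacobian (M_scheme \<alpha>) 4 (test_field \<alpha>) h"
  assumes Y: "\<And>i. i < 3 \<Longrightarrow> Y i = test_stages \<alpha> h i"
    and D: "variational_stages (M_scheme \<alpha>) 4 (test_field \<alpha>) h Y D"
    and symp: "omega 2 (\<lambda>k. S Y D k 1) (\<lambda>k. S Y D k 3) = 1"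
    and nz: "\<alpha> \<noteq> 0" "h \<noteq> 0"
  shows "b * (b - 2 * a) = 0"
proof -
  let ?M = "M_scheme \<alpha>" and ?f = "test_field \<alpha>"
  \<comment> \<open>The derivative of the rate in x at the first stage, where t = - alpha * h and x = h.\<close>
  define \<gamma> where "\<gamma> = - 4 * \<alpha> ^ 4 * h ^ 3"
  define A where "A i j = rk_A ?M ! i ! j" for i j
  have s: "rk_stages ?M = 3" by (simp add: M_scheme_def)
  have Y01: "Y i 0 = (real i - 1) * (\<alpha> * h)" "Y i 1 = h" "Y i 3 = 0" if "i < 3" for i
    using that by (simp_all add: Y test_stages_def test_point_def)
  have rate_x: "test_rate_x \<alpha> (Y i 0) (Y i 1) = (if i = 0 then \<gamma> else 0)" if "i < 3" for i
    using that unfolding Y01[OF that]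
    by (auto simp: test_rate_x_def \<gamma>_def less_Suc_eq numeral_3_eq_3 algebra_simps power2_eq_square power3_eq_cube power4_eq_xxxx)
  have eq: "D i k l = (if k = l then 1 else 0) + h * (\<Sum>j<3. A i j * (\<Sum>m<4. jac ?f (Y j) k m * D j m l))"
    if "i < 3" "k < 4" "l < 4" for i k l
    using D that by (simp add: variational_stages_def s A_def)
  have D0: "D i 0 l = (if 0 = l then 1 else 0)" if "i < 3" "l < 4" for i l
    using eq[of i 0 l] that by (simp add: jac_test_field)
  have row1: "(\<Sum>m<4. jac ?f (Y j) 1 m * D j m l) = (if j = 0 then \<gamma> else 0) * D j 1 l"
    if "j < 3" "l < 4" "l \<noteq> 0" for j l
    using that by (simp add: sum_lessThan_4 jac_test_field[unfolded One_nat_def] D0 rate_x[OF that(1), unfolded One_nat_def])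
  have row3: "(\<Sum>m<4. jac ?f (Y j) 3 m * D j m l) = - (if j = 0 then \<gamma> else 0) * D j 3 l"
    if "j < 3" for j l
    using that Y01(3)[OF that]
    by (simp add: sum_lessThan_4 jac_test_field rate_x[OF that, unfolded One_nat_def])
  have D11: "D 0 1 1 = 1 + a * (h * \<gamma>) * D 0 1 1"
    using eq[of 0 1 1] row1[of _ 1] by (simp add: sum_lessThan_3 A_def a_def mult_ac)
  have D33: "D 0 3 3 = 1 - a * (h * \<gamma>) * D 0 3 3"
    using eq[of 0 3 3] by (simp add: sum_lessThan_3 row3 A_def a_def mult.left_commute mult.assoc)
  have D31: "D 0 3 1 = - (a * (h * \<gamma>)) * D 0 3 1"
    using eq[of 0 3 1] by (simp add: sum_lessThan_3 row3 A_def a_def mult.left_commute mult.assoc)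
  have "D 0 3 1 * (1 + a * (h * \<gamma>)) = 0" "D 0 3 3 * (1 + a * (h * \<gamma>)) = 1"
    using D31 D33 by (simp_all add: algebra_simps)
  then have D31: "D 0 3 1 = 0" by auto
  have S_eq: "S Y D k l = (if k = l then 1 else 0) + h * (\<Sum>j<3. rk_b ?M ! j * (\<Sum>m<4. jac ?f (Y j) k m * D j m l))" for k l
    by (simp add: S_def rk_jacobian_def s)
  have S0: "S Y D 0 l = (if 0 = l then 1 else 0)" for l by (simp add: S_eq jac_test_field)
  have S11: "S Y D 1 1 = 1 + b * (h * \<gamma>) * D 0 1 1"
    unfolding S_eq using row1[of _ 1] by (simp add: sum_lessThan_3 b_def)
  have S33: "S Y D 3 3 = 1 - b * (h * \<gamma>) * D 0 3 3"
    unfolding S_eq by (simp add: sum_lessThan_3 row3 b_def)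
  have S31: "S Y D 3 1 = 0"
    unfolding S_eq by (simp add: sum_lessThan_3 row3 D31[unfolded One_nat_def])
  have "omega 2 u v = u 0 * v 2 - u 2 * v 0 + (u 1 * v 3 - u 3 * v 1)" for u v
    by (simp add: omega_def numeral_eq_Suc)
  then have "S Y D 1 1 * S Y D 3 3 = 1"
    using symp by (simp add: S0 S31[unfolded One_nat_def])
  then have "(1 + b * (h * \<gamma>) * D 0 1 1) * (1 - b * (h * \<gamma>) * D 0 3 3) = 1"
    unfolding S11 S33 .
  then show ?thesis
    by (rule unit_multipliers_imp[OF D11 D33]) (use nz in \<open>simp add: \<gamma>_def\<close>)
qed

text \<open>
  One small step size suffices, since \<open>test_jacobian\<close> holds for every nonzero \<open>h\<close>.
\<close>

lemma symplectic_imp_diagonal_defect_zero: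
  assumes M: "rk_symplectic (M_scheme \<alpha>)" and nz: "\<alpha> \<noteq> 0"
  shows "rk_b (M_scheme \<alpha>) ! 0 * (rk_b (M_scheme \<alpha>) ! 0 - 2 * rk_A (M_scheme \<alpha>) ! 0 ! 0) = 0"
proof -
  let ?M = "M_scheme \<alpha>" and ?f = "test_field \<alpha>" and ?H = "test_hamiltonian \<alpha>"
  have f: "smooth_field 4 ?f"
    using smooth_field_hamiltonian_field[of 2 ?H] smooth_test_hamiltonian by simp
  obtain L where fb: "field_bound 4 ?f (1 + 1) L" using field_bound_exists[OF f] by blast
  have symp: "\<forall>\<^sub>F h in nhds 0. \<forall>y\<in>cube 4 1. symplectic_at 2 (rk_map ?M 4 ?f h) y"
    using M smooth_test_hamiltonian[of "2 * 2" \<alpha>] compactin_cube[of 4 1]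
    unfolding rk_symplectic_def by fastforce
  have "\<forall>\<^sub>F h in nhds 0. \<bar>h\<bar> * 1 \<le> 1/2 \<and> \<bar>h\<bar> * \<bar>\<alpha>\<bar> \<le> 1/2 \<and> \<bar>h\<bar> * (rk_size ?M * L) \<le> 1/2 \<and>
      (\<forall>y\<in>cube 4 1. symplectic_at 2 (rk_map ?M 4 ?f h) y) \<and>
      (\<forall>y \<in> cube 4 1. solves_stages ?M 4 ?f h y (internal_stages ?M 4 ?f h y) \<and>
       (\<exists>D. variational_stages ?M 4 ?f h (internal_stages ?M 4 ?f h y) D \<and>
         has_jacobian 4 (rk_map ?M 4 ?f h) (rk_jacobian ?M 4 ?f h (internal_stages ?M 4 ?f h y) D) y))"
    by (intro eventually_conj eventually_small_step symp eventually_rk_map_has_jacobian[OF f])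
  then obtain e where e: "e > 0" and ev: "\<And>h. dist h 0 < e \<Longrightarrow>
      \<bar>h\<bar> * 1 \<le> 1/2 \<and> \<bar>h\<bar> * \<bar>\<alpha>\<bar> \<le> 1/2 \<and> \<bar>h\<bar> * (rk_size ?M * L) \<le> 1/2 \<and>
      (\<forall>y\<in>cube 4 1. symplectic_at 2 (rk_map ?M 4 ?f h) y) \<and>
      (\<forall>y \<in> cube 4 1. solves_stages ?M 4 ?f h y (internal_stages ?M 4 ?f h y) \<and>
       (\<exists>D. variational_stages ?M 4 ?f h (internal_stages ?M 4 ?f h y) D \<and>
         has_jacobian 4 (rk_map ?M 4 ?f h) (rk_jacobian ?M 4 ?f h (internal_stages ?M 4 ?f h y) D) y))"
    unfolding eventually_nhds_metric by blast
  define h where "h = e / 2"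
  have h0: "h \<noteq> 0" and "dist h 0 < e" using e by (auto simp: h_def)
  note evh = ev[OF this(2)]
  have bounds: "\<bar>h\<bar> \<le> 1" "\<bar>h\<bar> * \<bar>\<alpha>\<bar> \<le> 1" and step: "\<bar>h\<bar> * (rk_size ?M * L) \<le> 1/2"
    using evh by auto
  note y = test_stages_in_cube(1)[OF bounds]
  define Y where "Y = internal_stages ?M 4 ?f h (test_point h)"
  obtain D where D: "variational_stages ?M 4 ?f h Y D"
    and S: "has_jacobian 4 (rk_map ?M 4 ?f h) (rk_jacobian ?M 4 ?f h Y D) (test_point h)"
    using evh y unfolding Y_def by blast
  obtain S' where S': "has_jacobian 4 (rk_map ?M 4 ?f h) S' (test_point h)" "symplectic_matrix 2 S'"
    using evh y unfolding symplectic_at_def by fastforce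
  have s: "rk_stages ?M = 3" by (simp add: M_scheme_def)
  have Y_eq: "Y i = test_stages \<alpha> h i" if "i < 3" for i
    unfolding Y_def
    by (rule internal_stages_eqI[OF fb y step test_stages_solve])
      (use test_stages_in_cube(2)[OF bounds] that s in auto)
  have "omega 2 (\<lambda>k. S' k 1) (\<lambda>k. S' k 3) = 1"
    using S'(2) unfolding symplectic_matrix_def omega_eq_J_mat by (simp add: J_mat_def)
  moreover have "omega 2 (\<lambda>k. S' k 1) (\<lambda>k. S' k 3)
      = omega 2 (\<lambda>k. rk_jacobian ?M 4 ?f h Y D k 1) (\<lambda>k. rk_jacobian ?M 4 ?f h Y D k 3)"
    by (intro omega_cong has_jacobian_unique[OF S'(1) S cube_topspace[OF y]]) auto
  ultimately show ?thesis
    using test_jacobian[OF Y_eq D _ nz h0] by simp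
qed

lemma M_scheme_symplectic_imp:
  assumes "\<alpha> > 0" "rk_symplectic (M_scheme \<alpha>)"
  shows "\<alpha> = sqrt 3 / 6"
proof -
  have "1 / (24 * \<alpha>\<^sup>2) * (1 / (24 * \<alpha>\<^sup>2) - 2 * (- (3/4) * \<alpha> + 1 / (16 * \<alpha>) + 1 / (48 * \<alpha>\<^sup>2))) = 0"
    using symplectic_imp_diagonal_defect_zero[OF assms(2)] assms(1) by (simp add: M_scheme_def)
  moreover have "1 / (24 * \<alpha>\<^sup>2) \<noteq> 0" using assms(1) by simp
  ultimately have "1 / (24 * \<alpha>\<^sup>2) - 2 * (- (3/4) * \<alpha> + 1 / (16 * \<alpha>) + 1 / (48 * \<alpha>\<^sup>2)) = 0"
    by (metis mult_eq_0_iff)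
  then have "3/2 * \<alpha> = 1 / (8 * \<alpha>)" by (simp add: algebra_simps)
  then have "\<alpha>\<^sup>2 = 1/12" using assms(1) by (simp add: field_simps power2_eq_square)
  then have "\<alpha>\<^sup>2 = (sqrt 3 / 6)\<^sup>2" by (simp add: power_divide)
  then show ?thesis using assms(1) by (simp add: power2_eq_iff_nonneg)
qed

theorem theorem1:
  fixes \<alpha> :: real
  assumes "\<alpha> > 0"
  shows "(rk_symplectic (M_scheme \<alpha>) \<longleftrightarrow> \<alpha> = sqrt 3 / 6) \<and>
    rk_equivalent (M_scheme (sqrt 3 / 6)) gauss_legendre2 \<and>
    same_one_step_map (rk_map (M_scheme (sqrt 3 / 6)))
      (\<lambda>d f h. rk_map Psi_scheme d f (h / 2) \<circ> rk_map Phi_scheme d f (h / 2))"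
  using M_scheme_symplectic_imp[OF assms] M_scheme_special_symplectic
    M_scheme_special_equivalent M_scheme_special_composition by blast

end
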